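(* Let $S$ be a finite triangularizable semigroup with identity. Let $\pi=\sum_{s\in S}p_s s$ be a probability measure on $S$ and let $L$ be a minimal left ideal of $S$. Let $M$ be the transition matrix of the associated random walk on $L$, i.e. the $|L|\times|L|$ matrix whose $(\ell_1,\ell_2)$ entry is $\sum_{s\in S,\ s\ell_1=\ell_2}p_s$. For each regular $\mathscr J$-class $J\in\mathscr U(S)$ fix an idempotent $e_J\in J$, with maximal subgroup $G_J$. Then $M$ has an eigenvalue $\lambda_\chi$ for each $J\in\mathscr U(S)$ and each irreducible complex character $\chi$ of $G_J$, given by \[\lambda_\chi=\sum_{s\ge_{\mathscr J}J}p_s\,\chi(e_Jse_J),\] and the multiplicity of $\lambda_\chi$ as an eigenvalue of $M$ is \[\frac1{|G_J|}\sum_{g\in G_J}\chi(g^{-1})\sum_{J'\in\mathscr U(S),\ J'\le J}\big|\mathrm{Fix}_L(e_{J'}ge_{J'})\big|\,\mu(J',J).\] Here eigenvalues are counted with algebraic multiplicity, these are all the eigenvalues of $M$, a multiplicity of $0$ means that $\chi$ contributes no eigenvalue, and if different characters yield the same value $\lambda_\chi$ then their multiplicities are added.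
   Context: A finite semigroup $S$ is triangularizable if it has a faithful representation by upper triangular matrices over $\mathbb C$. For $s,t\in S$ write $s\le_{\mathscr J}t$ if the principal two-sided ideal generated by $s$ is contained in that generated by $t$, and $s\mathrel{\mathscr J}t$ if these ideals are equal; $s\ge_{\mathscr J}J$ means that $J$ is contained in the principal ideal generated by $s$. A $\mathscr J$-class is regular if it contains an idempotent. $\mathscr U(S)$ is the set of regular $\mathscr J$-classes ordered by $\le_{\mathscr J}$, and $\mu$ is the M\"obius function of this poset. $G_J$ is the maximal subgroup of $S$ at $e_J$, i.e. the group of units of $e_JSe_J$; for $S$ triangularizable it is abelian, and if $s\ge_{\mathscr J}J$ then $e_Jse_J\in G_J$. A probability measure is a family $p_s\ge0$ with $\sum_{s}p_s=1$. For $s\in S$, $\mathrm{Fix}_L(s)=\{\ell\in L: s\ell=\ell\}$. *)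

theory Defs
  imports
    "HOL-Algebra.Group"
    "HOL-Algebra.Coset"
    "Jordan_Normal_Form.VS_Connect"
    "Jordan_Normal_Form.Char_Poly"
begin

section \<open>Triangularizable semigroups\<close>

text \<open>A representation of a semigroup is only required to be multiplicative; it need not
  send an identity element to the identity matrix.\<close>

definition triangularizable :: "('a, 'b) monoid_scheme \<Rightarrow> bool" where
  "triangularizable S \<longleftrightarrow>
    (\<exists>n (\<rho> :: 'a \<Rightarrow> complex mat).
       (\<forall>s\<in>carrier S. \<rho> s \<in> carrier_mat n n \<and> upper_triangular (\<rho> s)) \<and>
       (\<forall>s\<in>carrier S. \<forall>t\<in>carrier S. \<rho> (s \<otimes>\<^bsub>S\<^esub> t) = \<rho> s * \<rho> t) \<and>
       inj_on \<rho> (carrier S))"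


section \<open>Ideals and Green's relation J\<close>

text \<open>In a monoid the principal two-sided ideal generated by \<open>s\<close> is \<open>SsS\<close>.\<close>

definition principal_ideal :: "('a, 'b) monoid_scheme \<Rightarrow> 'a \<Rightarrow> 'a set" where
  "principal_ideal S s = {a \<otimes>\<^bsub>S\<^esub> s \<otimes>\<^bsub>S\<^esub> b | a b. a \<in> carrier S \<and> b \<in> carrier S}"

definition J_class :: "('a, 'b) monoid_scheme \<Rightarrow> 'a \<Rightarrow> 'a set" where
  "J_class S s = {t \<in> carrier S. principal_ideal S t = principal_ideal S s}"

definition idempotent_elem :: "('a, 'b) monoid_scheme \<Rightarrow> 'a \<Rightarrow> bool" where
  "idempotent_elem S e \<longleftrightarrow> e \<in> carrier S \<and> e \<otimes>\<^bsub>S\<^esub> e = e"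

definition regular_J_classes :: "('a, 'b) monoid_scheme \<Rightarrow> 'a set set" where
  "regular_J_classes S = {J \<in> J_class S ` carrier S. \<exists>e\<in>J. idempotent_elem S e}"

definition J_class_le :: "('a, 'b) monoid_scheme \<Rightarrow> 'a set \<Rightarrow> 'a set \<Rightarrow> bool" where
  "J_class_le S J J' \<longleftrightarrow> (\<forall>s\<in>J. \<forall>t\<in>J'. principal_ideal S s \<subseteq> principal_ideal S t)"

definition regular_J_order :: "('a, 'b) monoid_scheme \<Rightarrow> 'a set rel" where
  "regular_J_order S =
    {(J, J'). J \<in> regular_J_classes S \<and> J' \<in> regular_J_classes S \<and> J_class_le S J J'}"

definition left_ideal :: "('a, 'b) monoid_scheme \<Rightarrow> 'a set \<Rightarrow> bool" where
  "left_ideal S L \<longleftrightarrow>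
    L \<noteq> {} \<and> L \<subseteq> carrier S \<and> (\<forall>s\<in>carrier S. \<forall>l\<in>L. s \<otimes>\<^bsub>S\<^esub> l \<in> L)"

definition minimal_left_ideal :: "('a, 'b) monoid_scheme \<Rightarrow> 'a set \<Rightarrow> bool" where
  "minimal_left_ideal S L \<longleftrightarrow>
    left_ideal S L \<and> (\<forall>L'. left_ideal S L' \<and> L' \<subseteq> L \<longrightarrow> L' = L)"

definition Fix_on :: "('a, 'b) monoid_scheme \<Rightarrow> 'a set \<Rightarrow> 'a \<Rightarrow> 'a set" where
  "Fix_on S L s = {l \<in> L. s \<otimes>\<^bsub>S\<^esub> l = l}"

definition corner_monoid :: "('a, 'b) monoid_scheme \<Rightarrow> 'a \<Rightarrow> 'a monoid" where
  "corner_monoid S e =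
    \<lparr>carrier = {e \<otimes>\<^bsub>S\<^esub> s \<otimes>\<^bsub>S\<^esub> e | s. s \<in> carrier S},
     Group.monoid.mult = Group.monoid.mult S, one = e\<rparr>"

definition maximal_subgroup :: "('a, 'b) monoid_scheme \<Rightarrow> 'a \<Rightarrow> 'a monoid" where
  "maximal_subgroup S e = units_of (corner_monoid S e)"


section \<open>The Moebius function of a finite poset\<close>

text \<open>A poset is given by its order relation \<open>r\<close> on \<open>Field r\<close>. The guard makes the recursion
  \<open>\<mu>(x, y) = - (\<Sum>z. \<mu>(x, z))\<close>, with \<open>z\<close> ranging over \<open>x \<le> z < y\<close>, terminate for every \<open>r\<close>.\<close>

function moebius :: "'a rel \<Rightarrow> 'a \<Rightarrow> 'a \<Rightarrow> int" where
  "moebius r x y =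
    (if finite r \<and> partial_order_on (Field r) r \<and> (x, y) \<in> r then
       (if x = y then 1
        else - (\<Sum>z\<in>{z. (x, z) \<in> r \<and> (z, y) \<in> r \<and> z \<noteq> y}. moebius r x z))
     else 0)"
  by auto
termination
proof (relation "measure (\<lambda>(r, x, y). card {w. (w, y) \<in> r \<and> w \<noteq> y})", goal_cases)
  case 1
  show ?case by simp
next
  case (2 r x y z)
  then have fin: "finite r" and tr: "trans r" and anti: "antisym r"
    and zy: "(z, y) \<in> r" "z \<noteq> y"
    by (auto simp: partial_order_on_def preorder_on_def)
  have "finite {w. (w, y) \<in> r \<and> w \<noteq> y}"
    by (rule finite_subset[of _ "fst ` r"]) (use fin in force)+
  moreover have "{w. (w, z) \<in> r \<and> w \<noteq> z} \<subset> {w. (w, y) \<in> r \<and> w \<noteq> y}"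
    using zy tr anti by (auto dest: transD antisymD)
  ultimately show ?case
    by (simp add: psubset_card_mono)
qed

declare moebius.simps [simp del]


section \<open>Irreducible complex characters\<close>

definition matrix_representation ::
  "('g, 'b) monoid_scheme \<Rightarrow> nat \<Rightarrow> ('g \<Rightarrow> complex mat) \<Rightarrow> bool" where
  "matrix_representation G n \<rho> \<longleftrightarrow>
    (\<forall>g\<in>carrier G. \<rho> g \<in> carrier_mat n n) \<and>
    \<rho> \<one>\<^bsub>G\<^esub> = 1\<^sub>m n \<and>
    (\<forall>g\<in>carrier G. \<forall>h\<in>carrier G. \<rho> (g \<otimes>\<^bsub>G\<^esub> h) = \<rho> g * \<rho> h)"

definition irreducible_representation ::
  "('g, 'b) monoid_scheme \<Rightarrow> nat \<Rightarrow> ('g \<Rightarrow> complex mat) \<Rightarrow> bool" where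
  "irreducible_representation G n \<rho> \<longleftrightarrow>
    matrix_representation G n \<rho> \<and> n > 0 \<and>
    (\<forall>W. VectorSpace.subspace class_ring W (module_vec TYPE(complex) n) \<and>
         (\<forall>g\<in>carrier G. \<forall>w\<in>W. \<rho> g *\<^sub>v w \<in> W)
         \<longrightarrow> W = {0\<^sub>v n} \<or> W = carrier_vec n)"

definition mat_trace :: "complex mat \<Rightarrow> complex" where
  "mat_trace A = (\<Sum>i<dim_row A. A $$ (i, i))"

text \<open>Characters are restricted to the carrier (and \<open>undefined\<close> elsewhere), so that each
  character corresponds to exactly one HOL function and can be summed over.\<close>

definition irr_characters :: "('g, 'b) monoid_scheme \<Rightarrow> ('g \<Rightarrow> complex) set" where
  "irr_characters G =
    {restrict (\<lambda>g. mat_trace (\<rho> g)) (carrier G) | n \<rho>. irreducible_representation G n \<rho>}"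


section \<open>The random walk\<close>

text \<open>The rows and columns are indexed through an enumeration \<open>ix\<close> of the state space
  by \<open>{..<n}\<close>.\<close>

definition walk_matrix ::
  "('a, 'b) monoid_scheme \<Rightarrow> ('a \<Rightarrow> real) \<Rightarrow> nat \<Rightarrow> (nat \<Rightarrow> 'a) \<Rightarrow> complex mat" where
  "walk_matrix S p n ix =
    mat n n (\<lambda>(i, j).
      complex_of_real (\<Sum>s\<in>{s \<in> carrier S. s \<otimes>\<^bsub>S\<^esub> ix i = ix j}. p s))"

definition walk_eigenvalue ::
  "('a, 'b) monoid_scheme \<Rightarrow> ('a \<Rightarrow> real) \<Rightarrow> ('a set \<Rightarrow> 'a) \<Rightarrow> 'a set \<Rightarrow> ('a \<Rightarrow> complex) \<Rightarrow> complex"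
  where
  "walk_eigenvalue S p e J \<chi> =
    (\<Sum>s\<in>{s \<in> carrier S. J \<subseteq> principal_ideal S s}.
       complex_of_real (p s) * \<chi> (e J \<otimes>\<^bsub>S\<^esub> s \<otimes>\<^bsub>S\<^esub> e J))"

definition walk_multiplicity ::
  "('a, 'b) monoid_scheme \<Rightarrow> 'a set \<Rightarrow> ('a set \<Rightarrow> 'a) \<Rightarrow> 'a set \<Rightarrow> ('a \<Rightarrow> complex) \<Rightarrow> complex"
  where
  "walk_multiplicity S L e J \<chi> =
    (let G = maximal_subgroup S (e J) in
      1 / of_nat (card (carrier G)) *
      (\<Sum>g\<in>carrier G. \<chi> (inv\<^bsub>G\<^esub> g) *
        (\<Sum>J'\<in>{J' \<in> regular_J_classes S. J_class_le S J' J}.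
           of_nat (card (Fix_on S L (e J' \<otimes>\<^bsub>S\<^esub> g \<otimes>\<^bsub>S\<^esub> e J'))) *
           of_int (moebius (regular_J_order S) J' J))))"

end

theory Submission
  imports Defs "HOL-Library.Function_Algebras" "HOL-Algebra.Multiplicative_Group"
begin

text \<open>
  Let \<open>M\<close> be the transition matrix. It acts on complex functions on \<open>L\<close> by
  \<open>(M f)(l) = (\<Sum>s. p s * f (s l))\<close>, so it is the average over \<open>\<pi>\<close> of the
  left translations of functions. The whole proof rests on triangularizing these translations.

  \<^bold>\<open>Triangularization.\<close> Let \<open>r s a b\<close> be the entries of a faithful representation by upper triangular
  matrices. Products \<open>r l a1 b1 * ... * r l ak bk\<close>, viewed as functions of \<open>l\<close>, span all functions
  on \<open>L\<close>, because the entries separate points. As \<open>r (s l) a b\<close> is the sum of the terms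
  \<open>r s a k * r l k b\<close> with \<open>k \<ge> a\<close>, left translation by \<open>s\<close> multiplies such a monomial by the product
  of the diagonal entries \<open>r s ai ai\<close>, up to monomials in which some first index has grown. A basis
  chosen greedily along this order (\<open>simultaneous_triangularization\<close>) makes all translations upper
  triangular at once. The diagonal consists of multiplicative functions \<open>\<theta> i : S \<rightarrow> \<complex>\<close> with
  \<open>\<theta> i 1 = 1\<close>; hence \<open>M\<close> has the eigenvalues \<open>\<Sum>s. p s * \<theta> i s\<close>, with algebraic multiplicity, and comparing
  traces gives \<open>|Fix_L(s)| = (\<Sum>i. \<theta> i s)\<close> (\<open>walk_decomposition\<close>).

  \<^bold>\<open>Apex.\<close> Each \<open>\<theta> i\<close> has an apex: a regular J-class \<open>J\<close> such that \<open>\<theta> i s \<noteq> 0\<close> exactly when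
  \<open>s \<ge> J\<close>. If \<open>s \<ge> J\<close>, then \<open>e s e\<close> lies in the maximal subgroup \<open>G\<close> at \<open>e = e J\<close>, so \<open>\<theta> i\<close> is recovered from
  its restriction \<open>\<chi>\<close> to \<open>G\<close> and the eigenvalue is the \<open>\<lambda>\<close> attached to \<open>(J, \<chi>)\<close>. The group \<open>G\<close> is abelian, so
  its irreducible characters are its linear characters. Both facts on \<open>G\<close> follow from
  \<open>periodic_eq_idempotent\<close>: a periodic element of \<open>e S e\<close> with the same diagonal as \<open>e\<close> is \<open>e\<close>.

  \<^bold>\<open>Counting.\<close> It remains to see that the multiplicity formula counts the indices \<open>i\<close> with apex \<open>J\<close>
  and restriction \<open>\<chi>\<close>. Write the fixed point numbers as sums of the \<open>\<theta> i\<close>. Since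
  \<open>\<theta> i (e' g e')\<close> is \<open>\<theta> i g\<close> if the class of \<open>e'\<close> is above the apex and \<open>0\<close> otherwise, Moebius inversion
  keeps exactly the \<open>\<theta> i\<close> with apex \<open>J\<close>, and orthogonality of characters of \<open>G\<close> keeps those that
  restrict to \<open>\<chi>\<close>.
\<close>

section \<open>Simultaneous triangularization\<close>

definition fun_scale :: "complex \<Rightarrow> (nat \<Rightarrow> complex) \<Rightarrow> nat \<Rightarrow> complex" where
  "fun_scale c f = (\<lambda>i. c * f i)"

interpretation fs: vector_space fun_scale
  by unfold_locales (auto simp: fun_scale_def algebra_simps fun_eq_iff)

lemma fun_scale_apply: "fun_scale c f i = c * f i"
  by (simp add: fun_scale_def)

lemma sum_fun_apply: "(\<Sum>x\<in>A. f x) i = (\<Sum>x\<in>A. f x i)"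
  by (induction A rule: infinite_finite_induct) auto

lemma zero_outside_in_span:
  assumes "\<And>i. i \<ge> n \<Longrightarrow> f i = 0"
  shows "f \<in> fs.span ((\<lambda>k i. if i = k then 1 else 0) ` {..<n})"
proof -
  have eq: "f = (\<Sum>k<n. fun_scale (f k) (\<lambda>i. if i = k then 1 else 0))"
    using assms by (auto simp: fun_eq_iff sum_fun_apply fun_scale_apply if_distrib cong: if_cong) 
  show ?thesis
    by (subst eq) (intro fs.span_sum fs.span_scale fs.span_base, auto)
qed

lemma subspace_zero_outside: "fs.subspace {f. \<forall>i\<ge>n. f i = 0}"
  by (auto simp: fs.subspace_def fun_scale_apply)

lemma dim_zero_outside: "fs.dim {f. \<forall>i\<ge>n. f i = 0} = n"
proof -
  let ?u = "\<lambda>(k::nat) i. if i = k then 1 else (0::complex)"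
  have inj: "inj_on ?u {..<n}"
    by (auto simp: inj_on_def fun_eq_iff split: if_splits)
  have ind: "fs.independent (?u ` {..<n})"
  proof (subst fs.independent_explicit_finite_subsets, intro allI impI ballI)
    fix T c x assume T: "T \<subseteq> ?u ` {..<n}" "finite T" "(\<Sum>v\<in>T. fun_scale (c v) v) = 0" "x \<in> T"
    from T obtain k where k: "x = ?u k" "k < n" by auto
    have "0 = (\<Sum>v\<in>T. fun_scale (c v) v) k" using T(3) by simp
    also have "\<dots> = (\<Sum>v\<in>T. c v * v k)" by (simp add: sum_fun_apply fun_scale_apply)
    also have "\<dots> = (\<Sum>v\<in>T. if v = x then c v else 0)"
    proof (rule sum.cong[OF refl])
      fix v assume "v \<in> T"
      then obtain m where "v = ?u m" "m < n" using T(1) by auto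
      then show "c v * v k = (if v = x then c v else 0)" using k by (auto simp: fun_eq_iff)
    qed
    also have "\<dots> = c x" using T by simp
    finally show "c x = 0" by simp
  qed
  show ?thesis
  proof (rule fs.dim_unique)
    show "?u ` {..<n} \<subseteq> {f. \<forall>i\<ge>n. f i = 0}" by auto
    show "{f. \<forall>i\<ge>n. f i = 0} \<subseteq> fs.span (?u ` {..<n})"
      using zero_outside_in_span by auto
    show "card (?u ` {..<n}) = n" using inj by (simp add: card_image)
  qed (use ind in auto)
qed

text \<open>Scanning the list and keeping a vector only if it is new makes the span of any initial segment of
  \<open>us\<close> equal to the span of the initial segment of \<open>ws\<close> before the corresponding vector. A family that
  is triangular along \<open>ws\<close> therefore stays triangular along \<open>us\<close>, with the same diagonal coefficients.\<close>

lemma greedy_basis: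
  fixes v :: "'w \<Rightarrow> nat \<Rightarrow> complex"
  shows "\<exists>us. distinct (map v us) \<and> fs.independent (v ` set us) \<and>
     fs.span (v ` set us) = fs.span (v ` set ws) \<and>
     (\<forall>j<length us. \<exists>k<length ws. us ! j = ws ! k \<and>
        fs.span (v ` set (take k ws)) = fs.span (v ` set (take j us)))"
proof (induction ws rule: rev_induct)
  case Nil
  show ?case by (rule exI[of _ "[]"]) (simp add: fs.independent_empty)
next
  case (snoc w ws)
  then obtain us where us: "distinct (map v us)" "fs.independent (v ` set us)"
     "fs.span (v ` set us) = fs.span (v ` set ws)"
     "\<And>j. j<length us \<Longrightarrow> \<exists>k<length ws. us ! j = ws ! k \<and>
        fs.span (v ` set (take k ws)) = fs.span (v ` set (take j us))" by auto
  show ?case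
  proof (cases "v w \<in> fs.span (v ` set ws)")
    case True
    have "\<exists>k<length (ws @ [w]). us ! j = (ws @ [w]) ! k \<and>
        fs.span (v ` set (take k (ws @ [w]))) = fs.span (v ` set (take j us))"
      if "j < length us" for j
    proof -
      from us(4)[OF that] obtain k where "k<length ws" "us ! j = ws ! k"
        "fs.span (v ` set (take k ws)) = fs.span (v ` set (take j us))" by auto
      then show ?thesis by (intro exI[of _ k]) (auto simp: nth_append)
    qed
    with us True show ?thesis
      by (intro exI[of _ us]) (auto simp: fs.span_redundant)
  next
    case False
    have "\<exists>k<length (ws @ [w]). (us @ [w]) ! j = (ws @ [w]) ! k \<and>
        fs.span (v ` set (take k (ws @ [w]))) = fs.span (v ` set (take j (us @ [w])))"
      if "j < length (us @ [w])" for j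
    proof (cases "j < length us")
      case True
      from us(4)[OF this] obtain k where "k<length ws" "us ! j = ws ! k"
        "fs.span (v ` set (take k ws)) = fs.span (v ` set (take j us))" by auto
      then show ?thesis using True by (intro exI[of _ k]) (auto simp: nth_append)
    next
      case False
      then have "j = length us" using that by auto
      then show ?thesis using us(3) by (intro exI[of _ "length ws"]) auto
    qed
    moreover have "v w \<notin> fs.span (v ` set us)" using False us(3) by simp
    moreover have "v w \<notin> v ` set us" using calculation(2) fs.span_base by blast
    moreover have "fs.span (insert (v w) (v ` set us)) = fs.span (insert (v w) (v ` set ws))"
      using us(3) unfolding fs.span_insert by simp
    ultimately show ?thesis using us(1,2)
      by (intro exI[of _ "us @ [w]"]) (auto simp: fs.independent_insert)
  qed
qed

lemma in_span_nth:
  fixes v :: "'w \<Rightarrow> nat \<Rightarrow> complex"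
  assumes "f \<in> fs.span (v ` set us)"
  obtains c where "f = (\<Sum>i<length us. fun_scale (c i) (v (us ! i)))"
proof -
  have "\<exists>c. f = (\<Sum>i<length us. fun_scale (c i) (v (us ! i)))" using assms
  proof (induction us arbitrary: f rule: rev_induct)
    case Nil
    then have "f = 0" by simp
    then show ?case by simp
  next
    case (snoc u us)
    then obtain k where "f - fun_scale k (v u) \<in> fs.span (v ` set us)"
      by (auto simp: fs.span_insert)
    from snoc.IH[OF this] obtain c where
      c: "f - fun_scale k (v u) = (\<Sum>i<length us. fun_scale (c i) (v (us ! i)))" by blast
    have "f = (f - fun_scale k (v u)) + fun_scale k (v u)" by simp
    also have "\<dots> = (\<Sum>i<length (us @ [u]). fun_scale ((c(length us := k)) i) (v ((us @ [u]) ! i)))"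
      unfolding c by (simp add: nth_append)
    finally show ?case by blast
  qed
  then show ?thesis using that by blast
qed

lemma independent_nth:
  fixes v :: "'w \<Rightarrow> nat \<Rightarrow> complex"
  assumes "distinct (map v us)" "fs.independent (v ` set us)"
    "(\<Sum>i<length us. fun_scale (c i) (v (us ! i))) = 0" "i < length us"
  shows "c i = 0"
proof -
  have inj: "inj_on (\<lambda>i. v (us ! i)) {..<length us}"
    using assms(1) by (auto simp: inj_on_def distinct_conv_nth)
  have im: "(\<lambda>i. v (us ! i)) ` {..<length us} = v ` set us"
    by (auto simp: set_conv_nth)
  define d where "d = c \<circ> the_inv_into {..<length us} (\<lambda>i. v (us ! i))"
  have d: "d (v (us ! i)) = c i" if "i < length us" for i
    using the_inv_into_f_f[OF inj] that by (simp add: d_def)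
  have "(\<Sum>x\<in>v ` set us. fun_scale (d x) x) = (\<Sum>i<length us. fun_scale (d (v (us ! i))) (v (us ! i)))"
    unfolding im[symmetric] by (subst sum.reindex[OF inj]) simp
  also have "\<dots> = 0" using assms(3) d by simp
  finally have "(\<Sum>x\<in>v ` set us. fun_scale (d x) x) = 0" .
  then have "d x = 0" if "x \<in> v ` set us" for x
    using assms(2) that unfolding fs.independent_explicit_finite_subsets by blast
  then show ?thesis using d[OF assms(4)] assms(4) by auto
qed

definition act_on :: "nat \<Rightarrow> complex mat \<Rightarrow> (nat \<Rightarrow> complex) \<Rightarrow> nat \<Rightarrow> complex" where
  "act_on n B f = (\<lambda>i. if i < n then \<Sum>j<n. B $$ (i, j) * f j else 0)"

text \<open>The weight \<open>wt\<close> describes a filtration of the spanning family \<open>v\<close> under which every \<open>A s\<close> is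
  triangular; the \<open>v w\<close> may be linearly dependent. Sorting \<open>W\<close> by weight and thinning it out with
  \<open>greedy_basis\<close> gives a basis, the columns of \<open>P\<close>, that triangularizes the whole family \<open>A\<close>.\<close>

lemma simultaneous_triangularization:
  fixes v :: "'w \<Rightarrow> nat \<Rightarrow> complex" and wt :: "'w \<Rightarrow> nat" and A :: "'s \<Rightarrow> complex mat"
  assumes A: "\<And>s. s \<in> S \<Longrightarrow> A s \<in> carrier_mat n n"
    and W: "finite W"
    and supp: "\<And>w i. w \<in> W \<Longrightarrow> i \<ge> n \<Longrightarrow> v w i = 0"
    and spanning: "\<And>f. (\<forall>i\<ge>n. f i = 0) \<Longrightarrow> f \<in> fs.span (v ` W)"
    and tri: "\<And>s w. s \<in> S \<Longrightarrow> w \<in> W \<Longrightarrow>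
       act_on n (A s) (v w) - fun_scale (\<theta> w s) (v w) \<in> fs.span (v ` {w' \<in> W. wt w' < wt w})"
  obtains us P Q where "length us = n" "set us \<subseteq> W" "P \<in> carrier_mat n n" "Q \<in> carrier_mat n n"
    "P * Q = 1\<^sub>m n" "Q * P = 1\<^sub>m n"
    "\<And>s i j. s \<in> S \<Longrightarrow> j \<le> i \<Longrightarrow> i < n \<Longrightarrow>
        (Q * A s * P) $$ (i, j) = (if i = j then \<theta> (us ! i) s else 0)"
proof -
  obtain ws0 where ws0: "set ws0 = W" using W finite_list by auto
  define ws where "ws = sort_key wt ws0"
  have ws: "set ws = W" "sorted (map wt ws)" using ws0 by (auto simp: ws_def)
  obtain us where us: "distinct (map v us)" "fs.independent (v ` set us)"
     "fs.span (v ` set us) = fs.span (v ` set ws)"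
     "\<And>j. j < length us \<Longrightarrow> \<exists>k<length ws. us ! j = ws ! k \<and>
        fs.span (v ` set (take k ws)) = fs.span (v ` set (take j us))"
    using greedy_basis[of v ws] by blast
  have usW: "set us \<subseteq> W"
  proof
    fix x assume "x \<in> set us"
    then obtain j where "j < length us" "x = us ! j" by (auto simp: set_conv_nth)
    with us(4)[of j] show "x \<in> W" using ws by auto
  qed
  have "fs.dim {f. \<forall>i\<ge>n. f i = 0} = card (v ` set us)"
  proof (rule fs.dim_unique)
    show "v ` set us \<subseteq> {f. \<forall>i\<ge>n. f i = 0}" using supp usW by auto
    show "{f. \<forall>i\<ge>n. f i = 0} \<subseteq> fs.span (v ` set us)" using spanning us(3) ws by auto
  qed (use us in auto)
  also have "card (v ` set us) = length us"
    using distinct_card[OF us(1)] by simp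
  finally have len: "length us = n" by (simp add: dim_zero_outside)

  have tri': "act_on n (A s) (v (us ! j)) - fun_scale (\<theta> (us ! j) s) (v (us ! j))
      \<in> fs.span (v ` set (take j us))" if s: "s \<in> S" and j: "j < n" for s j
  proof -
    from us(4)[of j] j len obtain k where k: "k < length ws" "us ! j = ws ! k"
      "fs.span (v ` set (take k ws)) = fs.span (v ` set (take j us))" by auto
    have "{w' \<in> W. wt w' < wt (ws ! k)} \<subseteq> set (take k ws)"
    proof
      fix x assume "x \<in> {w' \<in> W. wt w' < wt (ws ! k)}"
      then obtain l where l: "l < length ws" "x = ws ! l" "wt (ws ! l) < wt (ws ! k)"
        using ws by (auto simp: set_conv_nth)
      then have "l < k" using sorted_nth_mono[OF ws(2), of k l] k by (cases "l < k") auto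
      then show "x \<in> set (take k ws)" using l k by (auto simp: in_set_conv_nth)
    qed
    then have "fs.span (v ` {w' \<in> W. wt w' < wt (ws ! k)}) \<subseteq> fs.span (v ` set (take k ws))"
      by (intro fs.span_mono) auto
    moreover have "ws ! k \<in> W" using k ws by auto
    ultimately show ?thesis using tri[OF s, of "ws ! k"] k by auto
  qed

  define P where "P = mat n n (\<lambda>(i, j). v (us ! j) i)"
  have P: "P \<in> carrier_mat n n" by (simp add: P_def)
  have "det P \<noteq> 0"
  proof
    assume "det P = 0"
    then obtain x where x: "x \<in> carrier_vec n" "x \<noteq> 0\<^sub>v n" "P *\<^sub>v x = 0\<^sub>v n"
      using det_0_iff_vec_prod_zero[OF P] by auto
    have "(\<Sum>i<length us. fun_scale (x $ i) (v (us ! i))) = 0"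
    proof
      fix k
      show "(\<Sum>i<length us. fun_scale (x $ i) (v (us ! i))) k = 0 k"
      proof (cases "k < n")
        case True
        have e: "(P *\<^sub>v x) $ k = (\<Sum>i<n. v (us ! i) k * x $ i)"
          using True x(1) by (simp add: P_def scalar_prod_def lessThan_atLeast0)
        have "(\<Sum>i<n. v (us ! i) k * x $ i) = 0"
          unfolding e[symmetric] using x True by simp
        then show ?thesis by (simp add: sum_fun_apply fun_scale_apply len mult.commute)
      next
        case False
        then have "v (us ! i) k = 0" if "i < length us" for i
          using that supp[of "us ! i" k] usW by (auto simp: subset_eq)
        then show ?thesis by (simp add: sum_fun_apply fun_scale_apply)
      qed
    qed
    from independent_nth[OF us(1,2) this] len have "x $ i = 0" if "i < n" for i using that by auto
    then have "x = 0\<^sub>v n" using x(1) by auto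
    with x show False by auto
  qed
  from det_non_zero_imp_unit[OF P this, of "()"]
  obtain Q where Q: "Q \<in> carrier_mat n n" "P * Q = 1\<^sub>m n" "Q * P = 1\<^sub>m n"
    by (auto simp: Units_def ring_mat_def)

  have entries: "(Q * A s * P) $$ (i, j) = (if i = j then \<theta> (us ! i) s else 0)"
    if s: "s \<in> S" and ij: "j \<le> i" "i < n" for s i j
  proof -
    have j: "j < n" using ij by auto
    obtain c where c: "act_on n (A s) (v (us ! j)) - fun_scale (\<theta> (us ! j) s) (v (us ! j))
       = (\<Sum>i<length (take j us). fun_scale (c i) (v (take j us ! i)))"
      using in_span_nth[OF tri'[OF s j]] .
    define t where "t = vec n (\<lambda>i. if i < j then c i else if i = j then \<theta> (us ! j) s else 0)"
    have "A s *\<^sub>v col P j = P *\<^sub>v t"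
    proof (rule eq_vecI)
      fix k assume "k < dim_vec (P *\<^sub>v t)"
      then have k: "k < n" using P by simp
      have "(A s *\<^sub>v col P j) $ k = act_on n (A s) (v (us ! j)) k"
        using k j A[OF s] P by (auto simp: act_on_def scalar_prod_def P_def lessThan_atLeast0)
      also have "\<dots> = (act_on n (A s) (v (us ! j)) - fun_scale (\<theta> (us ! j) s) (v (us ! j))) k
          + \<theta> (us ! j) s * v (us ! j) k" by (simp add: fun_scale_apply)
      also have "\<dots> = (\<Sum>i<j. c i * v (us ! i) k) + \<theta> (us ! j) s * v (us ! j) k"
        unfolding c using j len by (simp add: sum_fun_apply fun_scale_apply)
      also have "\<dots> = (\<Sum>i<Suc j. v (us ! i) k * t $ i)"
        using j by (simp add: t_def mult.commute)
      also have "\<dots> = (\<Sum>i<n. v (us ! i) k * t $ i)"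
        by (rule sum.mono_neutral_left) (use j in \<open>auto simp: t_def\<close>)
      also have "\<dots> = (P *\<^sub>v t) $ k"
        using k by (simp add: P_def scalar_prod_def lessThan_atLeast0 t_def)
      finally show "(A s *\<^sub>v col P j) $ k = (P *\<^sub>v t) $ k" .
    qed (use A[OF s] P in auto)
    then have "Q *\<^sub>v (A s *\<^sub>v col P j) = Q *\<^sub>v (P *\<^sub>v t)" by simp
    also have "\<dots> = (Q * P) *\<^sub>v t"
      by (rule assoc_mult_mat_vec[symmetric]) (use Q P in \<open>auto simp: t_def\<close>)
    also have "\<dots> = t" unfolding Q by (simp add: t_def)
    finally have t: "Q *\<^sub>v (A s *\<^sub>v col P j) = t" .
    have "col (Q * A s * P) j = (Q * A s) *\<^sub>v col P j"
      using Q P A[OF s] j by (intro col_mult2) auto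
    also have "\<dots> = Q *\<^sub>v (A s *\<^sub>v col P j)"
      using Q P A[OF s] j by (intro assoc_mult_mat_vec) auto
    finally have "col (Q * A s * P) j $ i = t $ i" using t by simp
    then show ?thesis using ij Q P A[OF s] by (auto simp: t_def)
  qed
  show ?thesis using that[OF len usW P Q entries] by blast
qed

lemma mat_trace_mult_commute:
  assumes "A \<in> carrier_mat n n" "B \<in> carrier_mat n n"
  shows "mat_trace (A * B) = mat_trace (B * A)"
proof -
  have "mat_trace (A * B) = (\<Sum>i<n. \<Sum>j<n. A $$ (i, j) * B $$ (j, i))"
    using assms by (simp add: mat_trace_def scalar_prod_def lessThan_atLeast0)
  also have "\<dots> = (\<Sum>j<n. \<Sum>i<n. B $$ (j, i) * A $$ (i, j))"
    by (subst sum.swap) (simp add: mult.commute)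
  also have "\<dots> = mat_trace (B * A)"
    using assms by (simp add: mat_trace_def scalar_prod_def lessThan_atLeast0)
  finally show ?thesis .
qed

section \<open>Triangularizing the walk on a left ideal\<close>

definition linear_character :: "('a, 'b) monoid_scheme \<Rightarrow> ('a \<Rightarrow> complex) \<Rightarrow> bool" where
  "linear_character S \<theta> \<longleftrightarrow> \<theta> \<one>\<^bsub>S\<^esub> = 1 \<and>
     (\<forall>s\<in>carrier S. \<forall>t\<in>carrier S. \<theta> (s \<otimes>\<^bsub>S\<^esub> t) = \<theta> s * \<theta> t)"

text \<open>A finite monoid with a faithful upper triangular representation, given by its matrix entries.
  The entries are treated as functions on the monoid, and it is products of these that carry the
  proof.\<close>

locale triangular_monoid = monoid S for S (structure) +
  fixes d :: nat and r :: "'a \<Rightarrow> nat \<Rightarrow> nat \<Rightarrow> complex"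
  assumes finite_carrier: "finite (carrier S)"
    and r_mult: "\<And>s t i j. s \<in> carrier S \<Longrightarrow> t \<in> carrier S \<Longrightarrow> i < d \<Longrightarrow> j < d \<Longrightarrow>
        r (s \<otimes> t) i j = (\<Sum>k<d. r s i k * r t k j)"
    and r_lower: "\<And>s i j. s \<in> carrier S \<Longrightarrow> i < d \<Longrightarrow> j < i \<Longrightarrow> r s i j = 0"
    and r_faithful: "\<And>s t. s \<in> carrier S \<Longrightarrow> t \<in> carrier S \<Longrightarrow>
        (\<And>i j. i < d \<Longrightarrow> j < d \<Longrightarrow> r s i j = r t i j) \<Longrightarrow> s = t"

lemma triangularizable_imp_triangular_monoid:
  assumes "monoid S" "finite (carrier S)" "triangularizable S"
  obtains d r where "triangular_monoid S d r"
proof -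
  from assms(3) obtain n and \<rho> :: "'a \<Rightarrow> complex mat"
    where \<rho>: "\<And>s. s\<in>carrier S \<Longrightarrow> \<rho> s \<in> carrier_mat n n" "\<And>s. s\<in>carrier S \<Longrightarrow> upper_triangular (\<rho> s)"
      "\<And>s t. s\<in>carrier S \<Longrightarrow> t\<in>carrier S \<Longrightarrow> \<rho> (s \<otimes>\<^bsub>S\<^esub> t) = \<rho> s * \<rho> t"
      "inj_on \<rho> (carrier S)"
    unfolding triangularizable_def by blast
  interpret monoid S by fact
  have "triangular_monoid S n (\<lambda>s i j. \<rho> s $$ (i, j))"
  proof
    fix s t i j assume st: "s \<in> carrier S" "t \<in> carrier S" "i < n" "j < n"
    then show "\<rho> (s \<otimes>\<^bsub>S\<^esub> t) $$ (i, j) = (\<Sum>k<n. \<rho> s $$ (i, k) * \<rho> t $$ (k, j))"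
      using \<rho>(1)[OF st(1)] \<rho>(1)[OF st(2)] by (simp add: \<rho>(3) scalar_prod_def lessThan_atLeast0)
  next
    fix s i j assume "s \<in> carrier S" "i < n" "j < i"
    then show "\<rho> s $$ (i, j) = 0" using \<rho>(1)[of s] \<rho>(2)[of s] by (auto dest: upper_triangularD)
  next
    fix s t assume st: "s \<in> carrier S" "t \<in> carrier S"
      and eq: "\<And>i j. i < n \<Longrightarrow> j < n \<Longrightarrow> \<rho> s $$ (i, j) = \<rho> t $$ (i, j)"
    have "\<rho> s = \<rho> t" using \<rho>(1)[OF st(1)] \<rho>(1)[OF st(2)] eq by auto
    then show "s = t" using \<rho>(4) st by (auto dest: inj_onD)
  qed (use assms in auto)
  then show ?thesis using that by blast
qed

lemma (in triangular_monoid) r_diag_mult: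
  assumes "s \<in> carrier S" "t \<in> carrier S" "i < d"
  shows "r (s \<otimes> t) i i = r s i i * r t i i"
proof -
  have "r (s \<otimes> t) i i = (\<Sum>k<d. if k = i then r s i i * r t i i else 0)"
    unfolding r_mult[OF assms(1,2,3,3)]
    using r_lower assms by (intro sum.cong) (auto simp: linorder_neq_iff)
  then show ?thesis using assms(3) by simp
qed

locale triangular_walk = triangular_monoid +
  fixes L :: "'a set" and n :: nat and ix :: "nat \<Rightarrow> 'a"
  assumes left_ideal: "left_ideal S L" and ix: "bij_betw ix {..<n} L"
begin

lemma ix_closed: "i < n \<Longrightarrow> ix i \<in> carrier S"
  using left_ideal ix by (auto simp: left_ideal_def bij_betw_def)

lemma ix_index:
  assumes "s \<in> carrier S" "i < n"
  obtains j where "j < n" "s \<otimes> ix i = ix j"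
proof -
  have "s \<otimes> ix i \<in> L" using assms left_ideal ix by (auto simp: left_ideal_def bij_betw_def)
  then show ?thesis using that ix by (auto simp: bij_betw_def)
qed

lemma ix_eq_iff: "i < n \<Longrightarrow> j < n \<Longrightarrow> ix i = ix j \<longleftrightarrow> i = j"
  using ix by (auto simp: bij_betw_def inj_on_def)

definition monomial :: "(nat \<times> nat) list \<Rightarrow> 'a \<Rightarrow> complex" where
  "monomial w x = (\<Prod>(a, b)\<leftarrow>w. r x a b)"

definition monomial_vec :: "(nat \<times> nat) list \<Rightarrow> nat \<Rightarrow> complex" where
  "monomial_vec w i = (if i < n then monomial w (ix i) else 0)"

definition shifted_monomial :: "'a \<Rightarrow> (nat \<times> nat) list \<Rightarrow> nat \<Rightarrow> complex" where
  "shifted_monomial s w i = (if i < n then monomial w (s \<otimes> ix i) else 0)"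

text \<open>Raising a first index lowers the weight, so the monomials of smaller weight are the ones that a
  left translation may add.\<close>

definition weight :: "(nat \<times> nat) list \<Rightarrow> nat" where
  "weight w = (\<Sum>(a, b)\<leftarrow>w. d - a)"

definition diag_prod :: "(nat \<times> nat) list \<Rightarrow> 'a \<Rightarrow> complex" where
  "diag_prod w s = (\<Prod>(a, b)\<leftarrow>w. r s a a)"

definition index_pairs :: "(nat \<times> nat) set" where
  "index_pairs = {..<d} \<times> {..<d}"

definition lower_lists :: "(nat \<times> nat) list \<Rightarrow> (nat \<times> nat) list set" where
  "lower_lists w = {w'. set w' \<subseteq> index_pairs \<and> length w' = length w \<and> weight w' < weight w}"

text \<open>Multiplication by a matrix entry sends monomials to longer monomials, hence maps spans to spans.\<close>

lemma times_entry_in_span: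
  assumes "g \<in> fs.span (monomial_vec ` X)"
  shows "(\<lambda>i. r (ix i) a b * g i) \<in> fs.span (monomial_vec ` (#) (a, b) ` X)"
  using assms
proof (induction rule: fs.span_induct_alt)
  case base
  have "(\<lambda>i. r (ix i) a b * (0 :: nat \<Rightarrow> complex) i) = 0" by auto
  then show ?case by (metis fs.span_zero)
next
  case (step c x y)
  then obtain w where w: "x = monomial_vec w" "w \<in> X" by auto
  have "(\<lambda>i. r (ix i) a b * (fun_scale c x + y) i) =
      fun_scale c (monomial_vec ((a, b) # w)) + (\<lambda>i. r (ix i) a b * y i)"
    by (auto simp: w monomial_vec_def monomial_def fun_scale_apply algebra_simps)
  moreover have "monomial_vec ((a, b) # w) \<in> fs.span (monomial_vec ` (#) (a, b) ` X)"
    using w by (intro fs.span_base) auto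
  ultimately show ?case using step.IH by (simp add: fs.span_add fs.span_scale)
qed

text \<open>Expanding one factor \<open>r (s l) a b = (\<Sum>k. r s a k * r l k b)\<close> at a time, the term \<open>k = a\<close> contributes
  the diagonal entry and the terms \<open>k > a\<close> have smaller weight; terms with \<open>k < a\<close> vanish.\<close>

lemma shifted_minus_diag:
  assumes s: "s \<in> carrier S" and w: "set w \<subseteq> index_pairs"
  shows "shifted_monomial s w - fun_scale (diag_prod w s) (monomial_vec w) \<in> fs.span (monomial_vec ` lower_lists w)"
  using w
proof (induction w)
  case Nil
  have "shifted_monomial s [] - fun_scale (diag_prod [] s) (monomial_vec []) = 0"
    by (auto simp: fun_eq_iff shifted_monomial_def diag_prod_def monomial_vec_def monomial_def fun_scale_apply)
  then show ?case by (metis fs.span_zero)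
next
  case (Cons ab w)
  obtain a b where ab: "ab = (a, b)" "a < d" "b < d" using Cons.prems by (auto simp: index_pairs_def)
  define g where "g = shifted_monomial s w - fun_scale (diag_prod w s) (monomial_vec w)"
  have g: "g \<in> fs.span (monomial_vec ` lower_lists w)" unfolding g_def by (rule Cons.IH) (use Cons.prems in simp)
  have g_app: "monomial w (s \<otimes> ix i) = g i + diag_prod w s * monomial w (ix i)" if "i < n" for i
    using that by (simp add: g_def shifted_monomial_def monomial_vec_def fun_scale_apply)
  \<comment> \<open>the contribution of index \<open>k\<close>, with the leading term \<open>k = a\<close> removed\<close>
  define u where "u k = (if k = a then 0 else fun_scale (diag_prod w s) (monomial_vec ((k, b) # w))) +
      (\<lambda>i. r (ix i) k b * g i)" for k
  have g0: "g i = 0" if "\<not> i < n" for i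
    using that by (simp add: g_def shifted_monomial_def monomial_vec_def fun_scale_apply)
  have eq: "shifted_monomial s (ab # w) - fun_scale (diag_prod (ab # w) s) (monomial_vec (ab # w)) =
      (\<Sum>k<d. fun_scale (r s a k) (u k))" (is "?l = ?r")
  proof
    fix i
    show "?l i = ?r i"
    proof (cases "i < n")
      case True
      have "?l i = r (s \<otimes> ix i) a b * monomial w (s \<otimes> ix i) - r s a a * diag_prod w s * r (ix i) a b * monomial w (ix i)"
        using True by (simp add: ab shifted_monomial_def diag_prod_def monomial_vec_def monomial_def fun_scale_apply)
      also have "\<dots> = (\<Sum>k<d. r s a k * r (ix i) k b) * (g i + diag_prod w s * monomial w (ix i))
          - (\<Sum>k<d. if k = a then r s a a * diag_prod w s * r (ix i) a b * monomial w (ix i) else 0)"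
        using ab by (simp add: r_mult[OF s ix_closed[OF True]] g_app[OF True])
      also have "\<dots> = (\<Sum>k<d. r s a k * u k i)"
        unfolding sum_distrib_right sum_subtractf[symmetric]
        by (rule sum.cong) (use True in \<open>auto simp: u_def monomial_vec_def monomial_def fun_scale_apply algebra_simps\<close>)
      also have "\<dots> = ?r i" by (simp add: sum_fun_apply fun_scale_apply)
      finally show ?thesis .
    next
      case False
      then show ?thesis
        by (auto simp: shifted_monomial_def monomial_vec_def sum_fun_apply fun_scale_apply u_def g0)
    qed
  qed
  have u_in: "u k \<in> fs.span (monomial_vec ` lower_lists (ab # w))" if k: "a \<le> k" "k < d" for k
  proof -
    have "(#) (k, b) ` lower_lists w \<subseteq> lower_lists (ab # w)"
      using k ab by (auto simp: lower_lists_def index_pairs_def weight_def)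
    then have "fs.span (monomial_vec ` (#) (k, b) ` lower_lists w) \<subseteq> fs.span (monomial_vec ` lower_lists (ab # w))"
      by (intro fs.span_mono) auto
    then have 1: "(\<lambda>i. r (ix i) k b * g i) \<in> fs.span (monomial_vec ` lower_lists (ab # w))"
      using times_entry_in_span[OF g] by blast
    have "(k, b) # w \<in> lower_lists (ab # w)" if "k \<noteq> a"
      using that k ab Cons.prems by (auto simp: lower_lists_def index_pairs_def weight_def)
    then have 2: "(if k = a then 0 else fun_scale (diag_prod w s) (monomial_vec ((k, b) # w)))
        \<in> fs.span (monomial_vec ` lower_lists (ab # w))"
      by (cases "k = a") (simp_all add: fs.span_zero fs.span_scale fs.span_base)
    show ?thesis unfolding u_def by (rule fs.span_add[OF 2 1])
  qed
  have "fun_scale (r s a k) (u k) \<in> fs.span (monomial_vec ` lower_lists (ab # w))" if "k < d" for k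
  proof (cases "a \<le> k")
    case True
    then show ?thesis using u_in that by (intro fs.span_scale) auto
  next
    case False
    then have "r s a k = 0" using r_lower[OF s] ab by auto
    then have "fun_scale (r s a k) (u k) = 0" by (auto simp: fun_scale_apply)
    then show ?thesis by (metis fs.span_zero)
  qed
  then show ?case unfolding eq by (intro fs.span_sum) auto
qed

definition short_lists :: "nat \<Rightarrow> (nat \<times> nat) list set" where
  "short_lists m = {w. set w \<subseteq> index_pairs \<and> length w \<le> m}"

lemma span_short_lists_mono: "m \<le> m' \<Longrightarrow> fs.span (monomial_vec ` short_lists m) \<subseteq> fs.span (monomial_vec ` short_lists m')"
  by (intro fs.span_mono) (auto simp: short_lists_def)

text \<open>Each point to be avoided costs one factor: an entry that tells it apart from \<open>i0\<close>, shifted and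
  rescaled as in Lagrange interpolation. Bounding the length of the monomials by the number of
  points keeps the spanning family finite.\<close>

lemma separating_function:
  assumes "finite F" "F \<subseteq> {..<n} - {i0}" "i0 < n"
  shows "\<exists>g \<in> fs.span (monomial_vec ` short_lists (card F)). g i0 = 1 \<and> (\<forall>i\<in>F. g i = 0)"
  using assms
proof (induction F rule: finite_induct)
  case empty
  have "monomial_vec [] \<in> fs.span (monomial_vec ` short_lists 0)" by (intro fs.span_base) (auto simp: short_lists_def)
  moreover have "monomial_vec [] i0 = 1" using empty by (simp add: monomial_vec_def monomial_def)
  ultimately show ?case by (metis card.empty empty_iff)
next
  case (insert i1 F)
  then obtain g where g: "g \<in> fs.span (monomial_vec ` short_lists (card F))" "g i0 = 1" "\<And>i. i \<in> F \<Longrightarrow> g i = 0"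
    by auto
  have "ix i0 \<noteq> ix i1" using insert ix_eq_iff by auto
  then obtain a b where ab: "a < d" "b < d" "r (ix i0) a b \<noteq> r (ix i1) a b"
    using r_faithful[of "ix i0" "ix i1"] insert ix_closed by auto
  define h where "h = fun_scale (1 / (r (ix i0) a b - r (ix i1) a b))
     ((\<lambda>i. r (ix i) a b * g i) - fun_scale (r (ix i1) a b) g)"
  have "(#) (a, b) ` short_lists (card F) \<subseteq> short_lists (card (insert i1 F))"
    using insert.hyps ab by (auto simp: short_lists_def index_pairs_def)
  then have "fs.span (monomial_vec ` (#) (a, b) ` short_lists (card F)) \<subseteq> fs.span (monomial_vec ` short_lists (card (insert i1 F)))"
    by (intro fs.span_mono) auto
  moreover have "fs.span (monomial_vec ` short_lists (card F)) \<subseteq> fs.span (monomial_vec ` short_lists (card (insert i1 F)))"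
    using insert.hyps by (intro span_short_lists_mono) auto
  ultimately have "h \<in> fs.span (monomial_vec ` short_lists (card (insert i1 F)))"
    unfolding h_def using times_entry_in_span[OF g(1), of a b] g(1)
    by (intro fs.span_scale fs.span_diff) auto
  moreover have "h i0 = 1" using ab g by (simp add: h_def fun_scale_apply)
  moreover have "h i = 0" if "i \<in> insert i1 F" for i
    using that g by (auto simp: h_def fun_scale_apply)
  ultimately show ?case by blast
qed

lemma monomial_vec_outside: "i \<ge> n \<Longrightarrow> monomial_vec w i = 0"
  by (simp add: monomial_vec_def)

lemma monomials_span:
  assumes "\<forall>i\<ge>n. f i = 0"
  shows "f \<in> fs.span (monomial_vec ` short_lists n)"
proof -
  have unit: "(\<lambda>i. if i = k then 1 else 0) \<in> fs.span (monomial_vec ` short_lists n)" if k: "k < n" for k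
  proof -
    obtain g where g: "g \<in> fs.span (monomial_vec ` short_lists (card ({..<n} - {k})))" "g k = 1"
      "\<forall>i\<in>{..<n} - {k}. g i = 0"
      using separating_function[of "{..<n} - {k}" k] k by auto
    have "fs.span (monomial_vec ` short_lists (card ({..<n} - {k}))) \<subseteq> {f. \<forall>i\<ge>n. f i = 0}"
      by (intro fs.span_minimal subspace_zero_outside) (auto simp: monomial_vec_outside)
    then have g0: "g i = 0" if "i \<ge> n" for i using g(1) that by auto
    have "g i = (if i = k then 1 else 0)" for i
      using g(2,3) g0[of i] by (cases "i < n") auto
    then have "g = (\<lambda>i. if i = k then 1 else 0)" by blast
    moreover have "card ({..<n} - {k}) \<le> n" using card_mono[of "{..<n}" "{..<n} - {k}"] by auto
    ultimately show ?thesis using g(1) span_short_lists_mono by blast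
  qed
  then have "fs.span ((\<lambda>k i. if i = k then 1 else 0) ` {..<n}) \<subseteq> fs.span (monomial_vec ` short_lists n)"
    by (intro fs.span_minimal) auto
  then show ?thesis using zero_outside_in_span[of n f] assms by auto
qed

definition shift_mat :: "'a \<Rightarrow> complex mat" where
  "shift_mat s = mat n n (\<lambda>(i, j). if s \<otimes> ix i = ix j then 1 else 0)"

lemma act_on_shift_mat:
  assumes "s \<in> carrier S"
  shows "act_on n (shift_mat s) (monomial_vec w) = shifted_monomial s w"
proof
  fix i
  show "act_on n (shift_mat s) (monomial_vec w) i = shifted_monomial s w i"
  proof (cases "i < n")
    case True
    then obtain j where j: "j < n" "s \<otimes> ix i = ix j" using ix_index assms by blast
    have "act_on n (shift_mat s) (monomial_vec w) i = (\<Sum>k<n. if k = j then monomial_vec w k else 0)"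
      unfolding act_on_def if_P[OF True]
      by (rule sum.cong) (use True j in \<open>auto simp: shift_mat_def ix_eq_iff\<close>)
    then show ?thesis using j True by (simp add: monomial_vec_def shifted_monomial_def)
  qed (simp add: act_on_def shifted_monomial_def)
qed

lemma diag_prod_mult:
  assumes "s \<in> carrier S" "t \<in> carrier S" "set w \<subseteq> index_pairs"
  shows "diag_prod w (s \<otimes> t) = diag_prod w s * diag_prod w t"
proof -
  have "r (s \<otimes> t) a a = r s a a * r t a a" if "a < d" for a
    using r_diag_mult assms that by blast
  then show ?thesis using assms(3)
    by (induction w) (auto simp: diag_prod_def index_pairs_def)
qed

lemma finite_short_lists: "finite (short_lists m)"
  unfolding short_lists_def by (rule finite_lists_length_le) (simp add: index_pairs_def)

text \<open>The transition matrix and the fixed point numbers see the same diagonal: the former through the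
  characteristic polynomial, the latter through the trace. That \<open>\<theta> i\<close> takes the value 1 at the identity
  comes from the basis: translation by the identity is the identity matrix in every basis, whatever
  idempotent matrix represents the identity of the monoid.\<close>

lemma walk_decomposition:
  obtains \<theta> where "\<And>i. i < n \<Longrightarrow> linear_character S (\<theta> i)"
    "\<And>s. s \<in> carrier S \<Longrightarrow> of_nat (card (Fix_on S L s)) = (\<Sum>i<n. \<theta> i s)"
    "\<And>p. char_poly (walk_matrix S p n ix) =
       (\<Prod>i<n. [:- (\<Sum>s\<in>carrier S. complex_of_real (p s) * \<theta> i s), 1:])"
proof -
  have shift_carrier: "shift_mat s \<in> carrier_mat n n" for s by (simp add: shift_mat_def)
  obtain us P Q where us: "length us = n" "set us \<subseteq> short_lists n"
    and P: "P \<in> carrier_mat n n" and Q: "Q \<in> carrier_mat n n"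
    and PQ: "P * Q = 1\<^sub>m n" "Q * P = 1\<^sub>m n"
    and tri: "\<And>s i j. s \<in> carrier S \<Longrightarrow> j \<le> i \<Longrightarrow> i < n \<Longrightarrow>
        (Q * shift_mat s * P) $$ (i, j) = (if i = j then diag_prod (us ! i) s else 0)"
  proof (rule simultaneous_triangularization[of "carrier S" shift_mat n "short_lists n" monomial_vec diag_prod weight])
    fix s w assume sw: "s \<in> carrier S" "w \<in> short_lists n"
    have "lower_lists w \<subseteq> {w' \<in> short_lists n. weight w' < weight w}" using sw by (auto simp: lower_lists_def short_lists_def)
    then have "fs.span (monomial_vec ` lower_lists w) \<subseteq> fs.span (monomial_vec ` {w' \<in> short_lists n. weight w' < weight w})"
      by (intro fs.span_mono) auto
    then show "act_on n (shift_mat s) (monomial_vec w) - fun_scale (diag_prod w s) (monomial_vec w)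
        \<in> fs.span (monomial_vec ` {w' \<in> short_lists n. weight w' < weight w})"
      using shifted_minus_diag[of s w] sw by (auto simp: act_on_shift_mat short_lists_def)
  qed (use finite_short_lists monomials_span shift_carrier in \<open>auto simp: monomial_vec_outside\<close>)
  define \<theta> where "\<theta> i = diag_prod (us ! i)" for i
  have us_pairs: "set (us ! i) \<subseteq> index_pairs" if "i < n" for i
  proof -
    have "us ! i \<in> short_lists n" using us that by (metis nth_mem subsetD)
    then show ?thesis by (simp add: short_lists_def)
  qed

  have lin: "linear_character S (\<theta> i)" if i: "i < n" for i
  proof -
    have "shift_mat \<one> = 1\<^sub>m n"
      by (auto simp: shift_mat_def one_mat_def ix_closed ix_eq_iff)
    then have "Q * shift_mat \<one> * P = 1\<^sub>m n" using P Q PQ by simp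
    then have "\<theta> i \<one> = 1" using tri[of \<one> i i] i by (simp add: \<theta>_def)
    then show ?thesis using us_pairs[OF i] by (auto simp: linear_character_def \<theta>_def diag_prod_mult)
  qed

  have fixed: "of_nat (card (Fix_on S L s)) = (\<Sum>i<n. \<theta> i s)" if s: "s \<in> carrier S" for s
  proof -
    have "of_nat (card (Fix_on S L s)) = (of_nat (card {i. i < n \<and> s \<otimes> ix i = ix i}) :: complex)"
    proof -
      have "bij_betw ix {i. i < n \<and> s \<otimes> ix i = ix i} (Fix_on S L s)"
        using ix unfolding bij_betw_def by (auto simp: Fix_on_def inj_on_def)
      then show ?thesis by (simp add: bij_betw_same_card)
    qed
    also have "\<dots> = (\<Sum>i<n. if s \<otimes> ix i = ix i then 1 else 0)"
      by (simp add: sum.If_cases Int_def lessThan_def)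
    also have "\<dots> = mat_trace (shift_mat s)" by (simp add: mat_trace_def shift_mat_def)
    also have "\<dots> = mat_trace (P * (Q * shift_mat s))"
      using P Q PQ shift_carrier[of s] by (simp flip: assoc_mult_mat)
    also have "\<dots> = mat_trace (Q * shift_mat s * P)"
      using P Q shift_carrier[of s] by (intro mat_trace_mult_commute) auto
    also have "\<dots> = (\<Sum>i<n. \<theta> i s)"
      unfolding mat_trace_def using P Q shift_carrier[of s] tri[OF s] by (auto simp: \<theta>_def)
    finally show ?thesis .
  qed

  have cp: "char_poly (walk_matrix S p n ix) =
       (\<Prod>i<n. [:- (\<Sum>s\<in>carrier S. complex_of_real (p s) * \<theta> i s), 1:])" for p
  proof -
    let ?M = "walk_matrix S p n ix"
    have M: "?M \<in> carrier_mat n n" by (simp add: walk_matrix_def)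
    have M_entry: "?M $$ (i, j) = (\<Sum>s\<in>carrier S. complex_of_real (p s) * shift_mat s $$ (i, j))"
      if "i < n" "j < n" for i j
    proof -
      have "?M $$ (i, j) = (\<Sum>s\<in>{s \<in> carrier S. s \<otimes> ix i = ix j}. complex_of_real (p s))"
        using that by (simp add: walk_matrix_def)
      also have "\<dots> = (\<Sum>s\<in>carrier S. if s \<otimes> ix i = ix j then complex_of_real (p s) else 0)"
        using finite_carrier by (simp add: sum.inter_filter)
      also have "\<dots> = (\<Sum>s\<in>carrier S. complex_of_real (p s) * shift_mat s $$ (i, j))"
        using that by (intro sum.cong) (auto simp: shift_mat_def)
      finally show ?thesis .
    qed
    define T where "T = Q * ?M * P"
    have T: "T \<in> carrier_mat n n" using P Q M by (simp add: T_def)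
    have conj: "(Q * B * P) $$ (i, j) = (\<Sum>k<n. \<Sum>l<n. Q $$ (i, l) * B $$ (l, k) * P $$ (k, j))"
      if "B \<in> carrier_mat n n" "i < n" "j < n" for B i j
    proof -
      have entry: "(C * D) $$ (i, j) = (\<Sum>k<n. C $$ (i, k) * D $$ (k, j))"
        if "C \<in> carrier_mat n n" "D \<in> carrier_mat n n" "i < n" "j < n"
        for C D :: "complex mat" and i j
        using that by (simp add: scalar_prod_def lessThan_atLeast0)
      show ?thesis
        using that by (simp add: entry[OF mult_carrier_mat[OF Q that(1)] P that(2,3)]
            entry[OF Q that(1) that(2)] sum_distrib_right)
    qed
    have T_entry: "T $$ (i, j) = (\<Sum>s\<in>carrier S. complex_of_real (p s) * (Q * shift_mat s * P) $$ (i, j))"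
      if ij: "i < n" "j < n" for i j
    proof -
      have "T $$ (i, j) = (\<Sum>k<n. \<Sum>l<n. \<Sum>s\<in>carrier S.
          complex_of_real (p s) * (Q $$ (i, l) * shift_mat s $$ (l, k) * P $$ (k, j)))"
        unfolding T_def conj[OF M ij]
        by (intro sum.cong refl) (simp add: M_entry sum_distrib_left sum_distrib_right mult_ac)
      also have "\<dots> = (\<Sum>k<n. \<Sum>s\<in>carrier S. \<Sum>l<n.
          complex_of_real (p s) * (Q $$ (i, l) * shift_mat s $$ (l, k) * P $$ (k, j)))"
        by (intro sum.cong refl sum.swap)
      also have "\<dots> = (\<Sum>s\<in>carrier S. \<Sum>k<n. \<Sum>l<n.
          complex_of_real (p s) * (Q $$ (i, l) * shift_mat s $$ (l, k) * P $$ (k, j)))"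
        by (rule sum.swap)
      also have "\<dots> = (\<Sum>s\<in>carrier S. complex_of_real (p s) * (Q * shift_mat s * P) $$ (i, j))"
        by (simp only: conj[OF shift_carrier ij] sum_distrib_left)
      finally show ?thesis .
    qed
    have "similar_mat ?M T"
    proof (rule similar_matI)
      show "{?M, T, P, Q} \<subseteq> carrier_mat n n" using M T P Q by auto
      have "P * T * Q = (P * Q) * ?M * (P * Q)"
        unfolding T_def using M P Q by (simp add: assoc_mult_mat[of _ n n _ n _ n])
      then show "?M = P * T * Q" using M PQ by simp
    qed (use PQ in auto)
    then have "char_poly ?M = char_poly T" by (rule char_poly_similar)
    also have "\<dots> = (\<Prod>a\<leftarrow>diag_mat T. [:- a, 1:])"
      using T T_entry tri by (intro char_poly_upper_triangular[OF T]) (auto intro!: upper_triangularI)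
    also have "\<dots> = (\<Prod>i<n. [:- T $$ (i, i), 1:])"
      using T by (simp add: diag_mat_def interv_sum_list_conv_sum_set_nat o_def
          prod.distinct_set_conv_list[symmetric] lessThan_atLeast0)
    also have "\<dots> = (\<Prod>i<n. [:- (\<Sum>s\<in>carrier S. complex_of_real (p s) * \<theta> i s), 1:])"
      using tri by (intro prod.cong) (auto simp: T_entry \<theta>_def)
    finally show ?thesis .
  qed
  show ?thesis using that[OF lin fixed cp] by blast
qed

end

section \<open>Moebius inversion\<close>

lemma moebius_sum_right:
  assumes "finite r" "partial_order_on (Field r) r" "(x, y) \<in> r"
  shows "(\<Sum>z\<in>{z. (x, z) \<in> r \<and> (z, y) \<in> r}. moebius r x z) = (if x = y then 1 else 0)"
proof -
  have anti: "antisym r" and rfl: "refl_on (Field r) r"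
    using assms by (auto simp: partial_order_on_def preorder_on_def)
  have yy: "(y, y) \<in> r" "(x, x) \<in> r" using rfl assms(3) by (auto simp: refl_on_def Field_def)
  show ?thesis
  proof (cases "x = y")
    case True
    then have "{z. (x, z) \<in> r \<and> (z, y) \<in> r} = {x}" using anti yy by (auto dest: antisymD)
    then show ?thesis using True assms yy by (simp add: moebius.simps)
  next
    case False
    have fin: "finite {z. (x, z) \<in> r \<and> (z, y) \<in> r \<and> z \<noteq> y}"
      by (rule finite_subset[of _ "fst ` r"]) (use assms(1) in force)+
    have "{z. (x, z) \<in> r \<and> (z, y) \<in> r} = insert y {z. (x, z) \<in> r \<and> (z, y) \<in> r \<and> z \<noteq> y}"
      using assms(3) yy by auto
    then have "(\<Sum>z\<in>{z. (x, z) \<in> r \<and> (z, y) \<in> r}. moebius r x z)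
        = moebius r x y + (\<Sum>z\<in>{z. (x, z) \<in> r \<and> (z, y) \<in> r \<and> z \<noteq> y}. moebius r x z)"
      using fin by simp
    also have "\<dots> = 0" using False assms by (subst moebius.simps) simp
    finally show ?thesis using False by simp
  qed
qed

text \<open>In the incidence algebra this says that a left inverse of the zeta function is also a right inverse.
  With \<open>D = \<zeta> * \<mu>\<close>, associativity and \<open>\<mu> * \<zeta> = 1\<close> give \<open>D * \<zeta> = \<zeta>\<close>, that is, \<open>D x\<close> sums to 1 over each interval
  from \<open>x\<close> to \<open>y\<close>. As \<open>D x x = 1\<close>, all other values vanish, by induction on \<open>y\<close>.\<close>

lemma moebius_sum_left:
  assumes "finite r" "partial_order_on (Field r) r" "(x, y) \<in> r"
  shows "(\<Sum>z\<in>{z. (x, z) \<in> r \<and> (z, y) \<in> r}. moebius r z y) = (if x = y then 1 else 0)"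
  using assms(3)
proof (induction "card {w. (w, y) \<in> r \<and> w \<noteq> y}" arbitrary: y rule: less_induct)
  case less
  have anti: "antisym r" and rfl: "refl_on (Field r) r" and tr: "trans r"
    using assms by (auto simp: partial_order_on_def preorder_on_def)
  have xx: "(x, x) \<in> r" "(y, y) \<in> r" using rfl less.prems by (auto simp: refl_on_def Field_def)
  have fin: "finite {z. (a, z) \<in> r \<and> P z}" for a P
    by (rule finite_subset[of _ "snd ` r"]) (use assms(1) in force)+
  have fin': "finite {z. (z, a) \<in> r \<and> P z}" for a P
    by (rule finite_subset[of _ "fst ` r"]) (use assms(1) in force)+
  define D where "D w = (\<Sum>z\<in>{z. (x, z) \<in> r \<and> (z, w) \<in> r}. moebius r z w)" for w
  have IH: "D w = (if x = w then 1 else 0)" if w: "(x, w) \<in> r" "(w, y) \<in> r" "w \<noteq> y" for w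
  proof -
    have "{v. (v, w) \<in> r \<and> v \<noteq> w} \<subset> {v. (v, y) \<in> r \<and> v \<noteq> y}"
      using w tr anti by (auto dest: transD antisymD)
    then have "card {v. (v, w) \<in> r \<and> v \<noteq> w} < card {v. (v, y) \<in> r \<and> v \<noteq> y}"
      by (rule psubset_card_mono[OF fin'])
    then show ?thesis unfolding D_def using less.hyps w by blast
  qed
  show ?case
  proof (cases "x = y")
    case True
    then have "{z. (x, z) \<in> r \<and> (z, y) \<in> r} = {x}" using anti xx by (auto dest: antisymD)
    then show ?thesis using True assms xx by (simp add: moebius.simps)
  next
    case False
    let ?I = "{w. (x, w) \<in> r \<and> (w, y) \<in> r}"
    have finI: "finite ?I" by (rule fin)
    have "(\<Sum>w\<in>?I. D w) = (\<Sum>w\<in>?I. \<Sum>z\<in>?I. if (z, w) \<in> r then moebius r z w else 0)"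
      unfolding D_def
      by (rule sum.cong[OF refl])
        (use tr finI in \<open>auto simp: sum.inter_filter[symmetric] dest: transD intro!: sum.cong\<close>)
    also have "\<dots> = (\<Sum>z\<in>?I. \<Sum>w\<in>?I. if (z, w) \<in> r then moebius r z w else 0)"
      by (rule sum.swap)
    also have "\<dots> = (\<Sum>z\<in>?I. \<Sum>w\<in>{w. (z, w) \<in> r \<and> (w, y) \<in> r}. moebius r z w)"
      by (rule sum.cong[OF refl])
        (use tr finI in \<open>auto simp: sum.inter_filter[symmetric] dest: transD intro!: sum.cong\<close>)
    also have "\<dots> = (\<Sum>z\<in>?I. if z = y then 1 else 0)"
      by (rule sum.cong[OF refl]) (use moebius_sum_right[OF assms(1,2)] in auto)
    also have "\<dots> = 1" using finI less.prems xx by simp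
    finally have "(\<Sum>w\<in>?I. D w) = 1" .
    moreover have "?I = insert y (insert x (?I - {x, y}))" using less.prems xx by auto
    then have "(\<Sum>w\<in>?I. D w) = D y + (D x + (\<Sum>w\<in>?I - {x, y}. D w))"
      using False finI by (metis (no_types, lifting) DiffD2 Diff_insert_absorb finite_Diff finite_insert
          insertE insertI1 insertI2 sum.insert)
    moreover have "D x = 1" using IH[of x] xx less.prems False by simp
    moreover have "(\<Sum>w\<in>?I - {x, y}. D w) = 0" by (rule sum.neutral) (use IH in auto)
    ultimately show ?thesis using False by (simp add: D_def)
  qed
qed

section \<open>Characters of finite abelian groups\<close>

lemma linear_character_inv:
  assumes "group G" "linear_character G \<theta>" "g \<in> carrier G"
  shows "\<theta> g * \<theta> (inv\<^bsub>G\<^esub> g) = 1" "\<theta> (inv\<^bsub>G\<^esub> g) * \<theta> g = 1"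
proof -
  interpret group G by fact
  show "\<theta> g * \<theta> (inv\<^bsub>G\<^esub> g) = 1"
    using assms(2,3) unfolding linear_character_def by (metis inv_closed r_inv)
  then show "\<theta> (inv\<^bsub>G\<^esub> g) * \<theta> g = 1" by (simp add: mult.commute)
qed

lemma linear_character_orthogonality:
  assumes "group G" "finite (carrier G)" "linear_character G \<chi>" "linear_character G \<theta>"
  shows "(\<Sum>g\<in>carrier G. \<chi> (inv\<^bsub>G\<^esub> g) * \<theta> g) =
     (if \<forall>g\<in>carrier G. \<chi> g = \<theta> g then of_nat (card (carrier G)) else 0)"
proof (cases "\<forall>g\<in>carrier G. \<chi> g = \<theta> g")
  case True
  then have "(\<Sum>g\<in>carrier G. \<chi> (inv\<^bsub>G\<^esub> g) * \<theta> g) = (\<Sum>g\<in>carrier G. 1)"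
    using linear_character_inv(2)[OF assms(1,4)] group.inv_closed[OF assms(1)]
    by (intro sum.cong) auto
  then show ?thesis using True by simp
next
  case False
  interpret group G by fact
  from False obtain h where h: "h \<in> carrier G" "\<chi> h \<noteq> \<theta> h" by auto
  let ?f = "\<lambda>g. \<chi> (inv\<^bsub>G\<^esub> g) * \<theta> g"
  have f_mult: "?f (h \<otimes>\<^bsub>G\<^esub> g) = ?f h * ?f g" if "g \<in> carrier G" for g
    using assms(3,4) that h by (simp add: linear_character_def inv_mult_group)
  have bij: "bij_betw (\<lambda>g. h \<otimes>\<^bsub>G\<^esub> g) (carrier G) (carrier G)"
    by (rule bij_betw_byWitness[where f' = "\<lambda>g. inv\<^bsub>G\<^esub> h \<otimes>\<^bsub>G\<^esub> g"])
      (use h in \<open>auto simp: m_assoc[symmetric]\<close>)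
  have "(\<Sum>g\<in>carrier G. ?f g) = (\<Sum>g\<in>carrier G. ?f (h \<otimes>\<^bsub>G\<^esub> g))"
    using sum.reindex_bij_betw[OF bij, of ?f] by simp
  also have "\<dots> = ?f h * (\<Sum>g\<in>carrier G. ?f g)"
    using f_mult by (simp add: sum_distrib_left)
  finally have "(1 - ?f h) * (\<Sum>g\<in>carrier G. ?f g) = 0" by (simp add: algebra_simps)
  moreover have "?f h \<noteq> 1"
  proof
    assume "?f h = 1"
    then have "\<chi> h * (\<chi> (inv\<^bsub>G\<^esub> h) * \<theta> h) = \<chi> h" by simp
    then show False using h linear_character_inv(1)[OF assms(1,3) h(1)]
      by (simp add: mult.assoc[symmetric])
  qed
  ultimately have "(\<Sum>g\<in>carrier G. ?f g) = 0" by simp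
  then show ?thesis using False by (simp only: if_False)
qed

lemma eigenvalue_exists:
  assumes "A \<in> carrier_mat n n" "n > 0"
  shows "\<exists>k. eigenvalue (A :: complex mat) k"
proof -
  have "degree (char_poly A) = n" using degree_monic_char_poly[OF assms(1)] by simp
  then have "\<not> constant (poly (char_poly A))" using assms(2) by (simp add: constant_degree)
  then obtain k where "poly (char_poly A) k = 0" using fundamental_theorem_of_algebra by blast
  then show ?thesis using eigenvalue_root_char_poly[OF assms(1)] by blast
qed

lemma subspace_vecI:
  assumes "W \<subseteq> carrier_vec n" "0\<^sub>v n \<in> W"
    "\<And>u v. u \<in> W \<Longrightarrow> v \<in> W \<Longrightarrow> u + v \<in> W" "\<And>c u. u \<in> W \<Longrightarrow> c \<cdot>\<^sub>v u \<in> W"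
  shows "VectorSpace.subspace class_ring W (module_vec TYPE(complex) n)"
proof -
  interpret vec_space "TYPE(complex)" n .
  show ?thesis
    unfolding VectorSpace.subspace_def LinearCombinations.submodule_def
    using assms vec_vs vec_module by (auto simp: module_vec_simps class_ring_simps)
qed

lemma subspace_vecD:
  assumes "VectorSpace.subspace class_ring W (module_vec TYPE(complex) n)"
  shows "W \<subseteq> carrier_vec n" "0\<^sub>v n \<in> W" "\<And>c u. u \<in> W \<Longrightarrow> c \<cdot>\<^sub>v u \<in> W"
proof -
  have "LinearCombinations.submodule class_ring W (module_vec TYPE(complex) n)"
    using assms by (simp add: VectorSpace.subspace_def)
  then show "W \<subseteq> carrier_vec n" "0\<^sub>v n \<in> W" "\<And>c u. u \<in> W \<Longrightarrow> c \<cdot>\<^sub>v u \<in> W"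
    by (auto simp: LinearCombinations.submodule_def module_vec_simps class_ring_simps)
qed

text \<open>Schur's lemma for an abelian group: an eigenspace of \<open>\<rho> g\<close> is invariant under the whole group.\<close>

lemma irreducible_comm_scalar:
  assumes "comm_group G" "irreducible_representation G n \<rho>" "g \<in> carrier G"
  shows "\<exists>k. \<forall>v\<in>carrier_vec n. \<rho> g *\<^sub>v v = k \<cdot>\<^sub>v v"
proof -
  interpret comm_group G by fact
  have \<rho>: "\<And>g. g \<in> carrier G \<Longrightarrow> \<rho> g \<in> carrier_mat n n"
    "\<And>g h. g \<in> carrier G \<Longrightarrow> h \<in> carrier G \<Longrightarrow> \<rho> (g \<otimes>\<^bsub>G\<^esub> h) = \<rho> g * \<rho> h" "n > 0"
    using assms(2) by (auto simp: irreducible_representation_def matrix_representation_def)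
  obtain k where k: "eigenvalue (\<rho> g) k" using eigenvalue_exists[OF \<rho>(1)[OF assms(3)] \<rho>(3)] by auto
  define W where "W = {v \<in> carrier_vec n. \<rho> g *\<^sub>v v = k \<cdot>\<^sub>v v}"
  have "VectorSpace.subspace class_ring W (module_vec TYPE(complex) n)"
    by (rule subspace_vecI)
      (use \<rho>(1)[OF assms(3)] in \<open>auto simp: W_def mult_add_distrib_mat_vec smult_add_distrib_vec
        mult_mat_vec smult_smult_assoc mult.commute\<close>)
  moreover have "\<rho> h *\<^sub>v w \<in> W" if "h \<in> carrier G" "w \<in> W" for h w
  proof -
    have w: "w \<in> carrier_vec n" "\<rho> g *\<^sub>v w = k \<cdot>\<^sub>v w" using that by (auto simp: W_def)
    have "\<rho> g *\<^sub>v (\<rho> h *\<^sub>v w) = (\<rho> g * \<rho> h) *\<^sub>v w"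
      by (rule assoc_mult_mat_vec[symmetric]) (use \<rho>(1) assms(3) that w in auto)
    also have "\<rho> g * \<rho> h = \<rho> h * \<rho> g" using \<rho>(2) assms(3) that m_comm by metis
    also have "(\<rho> h * \<rho> g) *\<^sub>v w = \<rho> h *\<^sub>v (\<rho> g *\<^sub>v w)"
      by (rule assoc_mult_mat_vec) (use \<rho>(1) assms(3) that w in auto)
    also have "\<dots> = k \<cdot>\<^sub>v (\<rho> h *\<^sub>v w)"
      unfolding w(2) by (rule mult_mat_vec) (use \<rho>(1) that w in auto)
    finally show ?thesis using \<rho>(1)[OF that(1)] w by (auto simp: W_def)
  qed
  ultimately have "W = {0\<^sub>v n} \<or> W = carrier_vec n"
    using assms(2) by (auto simp: irreducible_representation_def)
  moreover obtain v where "v \<in> W" "v \<noteq> 0\<^sub>v n"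
    using k \<rho>(1)[OF assms(3)] by (auto simp: eigenvalue_def eigenvector_def W_def)
  ultimately have "W = carrier_vec n" by auto
  then show ?thesis by (auto simp: W_def)
qed

text \<open>All operators are scalar, so every line is invariant; the first coordinate axis serves.\<close>

lemma irreducible_comm_dim_one:
  assumes "comm_group G" "irreducible_representation G n \<rho>"
  shows "n = 1"
proof -
  have n: "n > 0" using assms(2) by (simp add: irreducible_representation_def)
  define W where "W = {v \<in> carrier_vec n. \<forall>i<n. i \<noteq> 0 \<longrightarrow> v $ i = (0::complex)}"
  have "VectorSpace.subspace class_ring W (module_vec TYPE(complex) n)"
    by (rule subspace_vecI) (auto simp: W_def)
  moreover have "\<rho> h *\<^sub>v w \<in> W" if "h \<in> carrier G" "w \<in> W" for h w
    using irreducible_comm_scalar[OF assms that(1)] that(2) by (auto simp: W_def)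
  ultimately have "W = {0\<^sub>v n} \<or> W = carrier_vec n"
    using assms(2) by (auto simp: irreducible_representation_def)
  moreover have "unit_vec n 0 \<in> W" by (auto simp: W_def)
  moreover have "unit_vec n 0 \<noteq> (0\<^sub>v n :: complex vec)" using n by simp
  ultimately have "W = carrier_vec n" by auto
  then have "unit_vec n 1 \<in> W" by simp
  then show ?thesis using n by (cases "n = 1") (auto simp: W_def dest: spec[of _ 1])
qed

lemma irr_characters_comm_group:
  assumes "comm_group G"
  shows "irr_characters G = {restrict \<theta> (carrier G) | \<theta>. linear_character G \<theta>}"
proof (intro equalityI subsetI)
  interpret comm_group G by fact
  fix \<chi> assume "\<chi> \<in> irr_characters G"
  then obtain n \<rho> where \<rho>: "irreducible_representation G n \<rho>"
    and \<chi>: "\<chi> = restrict (\<lambda>g. mat_trace (\<rho> g)) (carrier G)" by (auto simp: irr_characters_def)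
  have n: "n = 1" using irreducible_comm_dim_one[OF assms \<rho>] .
  have rep: "\<And>g. g \<in> carrier G \<Longrightarrow> \<rho> g \<in> carrier_mat 1 1" "\<rho> \<one>\<^bsub>G\<^esub> = 1\<^sub>m 1"
    "\<And>g h. g \<in> carrier G \<Longrightarrow> h \<in> carrier G \<Longrightarrow> \<rho> (g \<otimes>\<^bsub>G\<^esub> h) = \<rho> g * \<rho> h"
    using \<rho> n by (auto simp: irreducible_representation_def matrix_representation_def)
  have "linear_character G (\<lambda>g. mat_trace (\<rho> g))"
    unfolding linear_character_def
  proof (intro conjI ballI)
    fix s t assume st: "s \<in> carrier G" "t \<in> carrier G"
    show "mat_trace (\<rho> (s \<otimes>\<^bsub>G\<^esub> t)) = mat_trace (\<rho> s) * mat_trace (\<rho> t)"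
      using rep(1)[OF st(1)] rep(1)[OF st(2)] by (simp add: rep(3)[OF st] mat_trace_def scalar_prod_def)
  qed (simp add: rep(2) mat_trace_def)
  then show "\<chi> \<in> {restrict \<theta> (carrier G) | \<theta>. linear_character G \<theta>}" using \<chi> by blast
next
  interpret comm_group G by fact
  fix \<chi> assume "\<chi> \<in> {restrict \<theta> (carrier G) | \<theta>. linear_character G \<theta>}"
  then obtain \<theta> where \<theta>: "linear_character G \<theta>" "\<chi> = restrict \<theta> (carrier G)" by auto
  define \<rho> where "\<rho> g = mat 1 1 (\<lambda>_. \<theta> g)" for g
  have "irreducible_representation G 1 \<rho>"
    unfolding irreducible_representation_def matrix_representation_def
  proof (intro conjI allI impI ballI)
    show "\<rho> \<one>\<^bsub>G\<^esub> = 1\<^sub>m 1" using \<theta> by (auto simp: \<rho>_def linear_character_def)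
    show "\<rho> (g \<otimes>\<^bsub>G\<^esub> h) = \<rho> g * \<rho> h" if "g \<in> carrier G" "h \<in> carrier G" for g h
      using \<theta> that by (auto simp: \<rho>_def linear_character_def scalar_prod_def)
    fix W assume "VectorSpace.subspace class_ring W (module_vec TYPE(complex) 1) \<and>
         (\<forall>g\<in>carrier G. \<forall>w\<in>W. \<rho> g *\<^sub>v w \<in> W)"
    then have W: "W \<subseteq> carrier_vec 1" "0\<^sub>v 1 \<in> W" "\<And>c u. u \<in> W \<Longrightarrow> c \<cdot>\<^sub>v u \<in> W"
      using subspace_vecD[of W 1] by auto
    show "W = {0\<^sub>v 1} \<or> W = carrier_vec 1"
    proof (rule disjCI)
      assume "W \<noteq> carrier_vec 1"
      have "w = 0\<^sub>v 1" if w: "w \<in> W" for w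
      proof (rule ccontr)
        assume "w \<noteq> 0\<^sub>v 1"
        moreover have w1: "w \<in> carrier_vec 1" using W(1) w by auto
        ultimately have w0: "w $ 0 \<noteq> 0" by (metis carrier_vecD eq_vecI index_zero_vec(1,2) less_one)
        have "v \<in> W" if "v \<in> carrier_vec 1" for v
        proof -
          have "v = (v $ 0 / w $ 0) \<cdot>\<^sub>v w"
            using w0 that w1 by (intro eq_vecI) auto
          then show ?thesis using W(3)[OF w] by metis
        qed
        then show False using \<open>W \<noteq> carrier_vec 1\<close> W(1) by blast
      qed
      then show "W = {0\<^sub>v 1}" using W(2) by blast
    qed
  qed (simp_all add: \<rho>_def)
  moreover have "\<chi> = restrict (\<lambda>g. mat_trace (\<rho> g)) (carrier G)"
    by (simp add: \<theta>(2) \<rho>_def mat_trace_def)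
  ultimately show "\<chi> \<in> irr_characters G" unfolding irr_characters_def by blast
qed

lemma linear_character_pow:
  assumes "monoid G" "linear_character G \<theta>" "g \<in> carrier G"
  shows "\<theta> (g [^]\<^bsub>G\<^esub> (k::nat)) = \<theta> g ^ k"
proof -
  interpret monoid G by fact
  show ?thesis using assms(2,3) by (induction k) (auto simp: linear_character_def)
qed

text \<open>Finiteness lets the counting argument split the indices by character, since a sum over an
  infinite set would be 0.\<close>

lemma finite_irr_characters:
  assumes "comm_group G" "finite (carrier G)"
  shows "finite (irr_characters G)"
proof -
  interpret comm_group G by fact
  have pos: "Coset.order G > 0" using assms(2) by (simp add: order_gt_0_iff_finite)
  have "irr_characters G \<subseteq> carrier G \<rightarrow>\<^sub>E {z. z ^ Coset.order G = (1::complex)}"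
  proof
    fix \<chi> assume "\<chi> \<in> irr_characters G"
    then obtain \<theta> where \<theta>: "linear_character G \<theta>" "\<chi> = restrict \<theta> (carrier G)"
      by (auto simp: irr_characters_comm_group[OF assms(1)])
    have "\<theta> g ^ Coset.order G = 1" if "g \<in> carrier G" for g
      using linear_character_pow[OF monoid_axioms \<theta>(1) that, of "Coset.order G"] \<theta>(1) that
      by (simp add: pow_order_eq_1 linear_character_def)
    then show "\<chi> \<in> carrier G \<rightarrow>\<^sub>E {z. z ^ Coset.order G = (1::complex)}" using \<theta>(2) by auto
  qed
  moreover have "finite {z. z ^ Coset.order G = (1::complex)}"
    using pos by (intro finite_roots_unity) auto
  ultimately show ?thesis using assms(2) finite_PiE finite_subset by (metis (no_types, lifting))
qed

section \<open>Maximal subgroups of triangular monoids\<close>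

lemma (in monoid) idempotent_power:
  assumes "finite (carrier G)" "x \<in> carrier G"
  obtains m :: nat where "m > 0" "(x [^] m) \<otimes> (x [^] m) = x [^] m"
proof -
  have "\<not> inj (\<lambda>k::nat. x [^] k)"
  proof
    assume "inj (\<lambda>k::nat. x [^] k)"
    moreover have "range (\<lambda>k::nat. x [^] k) \<subseteq> carrier G" using assms by auto
    ultimately show False using assms(1) by (meson finite_imageD finite_subset infinite_UNIV_nat)
  qed
  then obtain i j :: nat where "i < j" "x [^] i = x [^] j"
    unfolding inj_def by (metis linorder_neqE_nat)
  then obtain q where q: "q > 0" "x [^] i = x [^] (i + q)"
    by (metis less_imp_add_positive)
  have step: "x [^] (k + q) = x [^] k" if "k \<ge> i" for k
  proof -
    have "x [^] (k + q) = x [^] (i + q) \<otimes> x [^] (k - i)"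
      using that assms by (simp add: nat_pow_mult add.commute)
    also have "\<dots> = x [^] i \<otimes> x [^] (k - i)" using q by simp
    also have "\<dots> = x [^] k" using that assms by (simp add: nat_pow_mult)
    finally show ?thesis .
  qed
  have steps: "x [^] (k + l * q) = x [^] k" if "k \<ge> i" for k l
  proof (induction l)
    case (Suc l)
    have "x [^] (k + Suc l * q) = x [^] ((k + l * q) + q)" by (simp add: algebra_simps)
    also have "\<dots> = x [^] (k + l * q)" using that by (intro step) auto
    finally show ?case using Suc by simp
  qed simp
  \<comment> \<open>a multiple of the period beyond the preperiod \<open>i\<close>\<close>
  define m where "m = Suc i * q"
  have "m \<ge> i" using q by (cases q) (auto simp: m_def)
  then have "x [^] (m + Suc i * q) = x [^] m" by (rule steps)
  then have "(x [^] m) \<otimes> (x [^] m) = x [^] m"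
    using assms by (simp add: nat_pow_mult m_def)
  moreover have "m > 0" using q by (simp add: m_def)
  ultimately show ?thesis using that by blast
qed

context triangular_monoid
begin

lemma r_diag_pow:
  assumes "s \<in> carrier S" "i < d"
  shows "r (s [^] Suc k) i i = r s i i ^ Suc k"
  using assms by (induction k) (auto simp: r_diag_mult mult.commute)

text \<open>If \<open>s\<close> and \<open>t\<close> agree with \<open>e\<close> below the \<open>D\<close>-th superdiagonal, then in
  \<open>s t - e e = s (t - e) + (s - e) e\<close> only the extreme terms of the matrix products reach the \<open>D\<close>-th
  superdiagonal.\<close>

lemma product_near_idempotent:
  assumes e: "e \<in> carrier S" "e \<otimes> e = e" and st: "s \<in> carrier S" "t \<in> carrier S"
    and D: "D > 0"
    and near_s: "\<And>i j. i < d \<Longrightarrow> j < d \<Longrightarrow> j - i < D \<Longrightarrow> r s i j = r e i j"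
    and near_t: "\<And>i j. i < d \<Longrightarrow> j < d \<Longrightarrow> j - i < D \<Longrightarrow> r t i j = r e i j"
    and ij: "i < d" "j < d" "j - i \<le> D"
  shows "r (s \<otimes> t) i j - r e i j = r e i i * (r t i j - r e i j) + (r s i j - r e i j) * r e j j"
proof -
  have 1: "r s i k * (r t k j - r e k j) = (if k = i then r e i i * (r t i j - r e i j) else 0)"
    if k: "k < d" for k
  proof (cases "k < i")
    case True
    then show ?thesis using r_lower[of s i k] st ij by simp
  next
    case False
    show ?thesis
    proof (cases "k = i")
      case True
      then show ?thesis using near_s[of i i] D ij by simp
    next
      case F: False
      then have "j - k < D" using False ij D by auto
      then show ?thesis using near_t[of k j] k ij F by simp
    qed
  qed
  have 2: "(r s i k - r e i k) * r e k j = (if k = j then (r s i j - r e i j) * r e j j else 0)"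
    if k: "k < d" for k
  proof (cases "k \<le> j")
    case True
    show ?thesis
    proof (cases "k = j")
      case F: False
      then have "k - i < D" using True ij D by auto
      then show ?thesis using near_s[of i k] k ij F by simp
    qed simp
  next
    case False
    then show ?thesis using r_lower[of e k j] e k by simp
  qed
  have "r (s \<otimes> t) i j - r e i j = r (s \<otimes> t) i j - r (e \<otimes> e) i j" using e by simp
  also have "\<dots> = (\<Sum>k<d. r s i k * r t k j) - (\<Sum>k<d. r e i k * r e k j)"
    using r_mult[OF st ij(1,2)] r_mult[OF e(1) e(1) ij(1,2)] by simp
  also have "\<dots> = (\<Sum>k<d. r s i k * (r t k j - r e k j)) + (\<Sum>k<d. (r s i k - r e i k) * r e k j)"
    unfolding sum_subtractf[symmetric] sum.distrib[symmetric]
    by (intro sum.cong) (auto simp: algebra_simps)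
  also have "\<dots> = (\<Sum>k<d. if k = i then r e i i * (r t i j - r e i j) else 0) +
      (\<Sum>k<d. if k = j then (r s i j - r e i j) * r e j j else 0)"
    by (intro arg_cong2[of _ _ _ _ "(+)"] sum.cong refl 1 2) auto
  also have "\<dots> = r e i i * (r t i j - r e i j) + (r s i j - r e i j) * r e j j"
    using ij by simp
  finally show ?thesis .
qed

text \<open>Characteristic zero at work: if \<open>x\<close> first differs from \<open>e\<close> on the \<open>D\<close>-th superdiagonal, by \<open>N\<close>, then
  \<open>x ^ k\<close> differs from \<open>e\<close> there by \<open>k N\<close>, and periodicity forces \<open>N = 0\<close>. For \<open>m = 1\<close> the lemma says that
  an idempotent of \<open>e S e\<close> with the diagonal of \<open>e\<close> is \<open>e\<close>; for elements of the maximal subgroup at \<open>e\<close> it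
  says that they are determined to be trivial by their diagonal.\<close>

lemma periodic_eq_idempotent:
  assumes e: "e \<in> carrier S" "e \<otimes> e = e" and x: "x \<in> carrier S" "e \<otimes> x = x" "x \<otimes> e = x"
    and diag: "\<And>i. i < d \<Longrightarrow> r x i i = r e i i"
    and periodic: "x [^] Suc m = x" "m > 0"
  shows "x = e"
proof (rule r_faithful[OF x(1) e(1)])
  fix i j assume "i < d" "j < d"
  then show "r x i j = r e i j"
  proof (induction "j - i" arbitrary: i j rule: less_induct)
    case (less i j)
    show ?case
    proof (cases "i < j")
      case False
      then show ?thesis using diag[of i] r_lower[of x i j] r_lower[of e i j] x e less.prems
        by (cases "i = j") auto
    next
      case True
      define D where "D = j - i"
      have D: "D > 0" using True by (simp add: D_def)
      have near_x: "r x a b = r e a b" if "a < d" "b < d" "b - a < D" for a b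
        using less.hyps that by (simp add: D_def)
      define N where "N = r x i j - r e i j"
      have N1: "r e i i * N = N"
        using product_near_idempotent[OF e e(1) x(1) D _ near_x less.prems] x by (simp add: D_def N_def)
      have N2: "N * r e j j = N"
        using product_near_idempotent[OF e x(1) e(1) D near_x _ less.prems] x by (simp add: D_def N_def)
      have "(\<forall>a<d. \<forall>b<d. b - a < D \<longrightarrow> r (x [^] Suc k) a b = r e a b) \<and>
         r (x [^] Suc k) i j - r e i j = of_nat (Suc k) * N" for k
      proof (induction k)
        case 0
        then show ?case using near_x x by (simp add: N_def)
      next
        case (Suc k)
        define y where "y = x [^] Suc k"
        have y: "y \<in> carrier S" "x [^] Suc (Suc k) = y \<otimes> x" using x by (simp_all add: y_def)
        have near_y: "r y a b = r e a b" if "a < d" "b < d" "b - a < D" for a b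
          using Suc that by (simp add: y_def)
        have Ny: "r y i j - r e i j = of_nat (Suc k) * N" using Suc by (simp add: y_def)
        have "r (y \<otimes> x) a b = r e a b" if "a < d" "b < d" "b - a < D" for a b
          using product_near_idempotent[OF e y(1) x(1) D near_y near_x that(1,2)] that
            near_y[OF that] near_x[OF that] by simp
        moreover have "r (y \<otimes> x) i j - r e i j = N + of_nat (Suc k) * N"
          using product_near_idempotent[OF e y(1) x(1) D near_y near_x less.prems]
          by (simp add: D_def N1 Ny mult.assoc N2 flip: N_def)
        ultimately show ?case unfolding y(2) by (simp add: algebra_simps)
      qed
      from this[of m] have "N = of_nat (Suc m) * N" using periodic by (simp add: N_def)
      then have "of_nat m * N = 0" by (simp add: algebra_simps)
      then show ?thesis using periodic by (simp add: N_def)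
    qed
  qed
qed

lemma corner_monoid:
  assumes "e \<in> carrier S" "e \<otimes> e = e"
  shows "monoid (corner_monoid S e)"
proof (rule monoidI)
  fix x y assume "x \<in> carrier (corner_monoid S e)" "y \<in> carrier (corner_monoid S e)"
  then obtain s t where st: "s \<in> carrier S" "t \<in> carrier S" "x = e \<otimes> s \<otimes> e" "y = e \<otimes> t \<otimes> e"
    by (auto simp: corner_monoid_def)
  have "x \<otimes> y = e \<otimes> (s \<otimes> e \<otimes> (e \<otimes> t)) \<otimes> e" using st assms by (simp add: m_assoc)
  then show "x \<otimes>\<^bsub>corner_monoid S e\<^esub> y \<in> carrier (corner_monoid S e)"
    using st assms by (auto simp: corner_monoid_def)
next
  show "\<one>\<^bsub>corner_monoid S e\<^esub> \<in> carrier (corner_monoid S e)"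
    using assms by (auto simp: corner_monoid_def intro!: exI[of _ e])
qed (use assms in \<open>auto simp: corner_monoid_def m_assoc\<close>,
     use assms in \<open>auto simp: m_assoc[symmetric]\<close>)

lemma mem_corner_iff:
  assumes "e \<in> carrier S" "e \<otimes> e = e"
  shows "x \<in> carrier (corner_monoid S e) \<longleftrightarrow> x \<in> carrier S \<and> e \<otimes> x = x \<and> x \<otimes> e = x"
proof
  assume "x \<in> carrier (corner_monoid S e)"
  then obtain s where s: "s \<in> carrier S" "x = e \<otimes> s \<otimes> e" by (auto simp: corner_monoid_def)
  have "e \<otimes> x = (e \<otimes> e) \<otimes> s \<otimes> e" using s assms(1) by (simp add: m_assoc)
  moreover have "x \<otimes> e = e \<otimes> s \<otimes> (e \<otimes> e)" using s assms(1) by (simp add: m_assoc)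
  ultimately show "x \<in> carrier S \<and> e \<otimes> x = x \<and> x \<otimes> e = x" using s assms by simp
next
  assume "x \<in> carrier S \<and> e \<otimes> x = x \<and> x \<otimes> e = x"
  then show "x \<in> carrier (corner_monoid S e)"
    by (auto simp: corner_monoid_def intro!: exI[of _ x])
qed

lemma mem_maximal_subgroup_iff:
  assumes "e \<in> carrier S" "e \<otimes> e = e"
  shows "x \<in> carrier (maximal_subgroup S e) \<longleftrightarrow> x \<in> carrier S \<and> e \<otimes> x = x \<and> x \<otimes> e = x \<and>
     (\<exists>y\<in>carrier S. e \<otimes> y = y \<and> y \<otimes> e = y \<and> x \<otimes> y = e \<and> y \<otimes> x = e)"
proof -
  have "x \<in> carrier (maximal_subgroup S e) \<longleftrightarrow> x \<in> carrier (corner_monoid S e) \<and>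
     (\<exists>y\<in>carrier (corner_monoid S e). x \<otimes> y = e \<and> y \<otimes> x = e)"
  proof -
    have "a \<otimes>\<^bsub>corner_monoid S e\<^esub> b = a \<otimes> b" "\<one>\<^bsub>corner_monoid S e\<^esub> = e" for a b
      by (simp_all add: corner_monoid_def)
    then show ?thesis by (auto simp: maximal_subgroup_def units_of_def Units_def)
  qed
  then show ?thesis unfolding mem_corner_iff[OF assms] Bex_def by (simp only: conj_assoc)
qed

lemma maximal_subgroup_simps:
  "\<one>\<^bsub>maximal_subgroup S e\<^esub> = e" "x \<otimes>\<^bsub>maximal_subgroup S e\<^esub> y = x \<otimes> y"
  by (simp_all add: maximal_subgroup_def units_of_def corner_monoid_def)

lemma group_maximal_subgroup:
  assumes "e \<in> carrier S" "e \<otimes> e = e"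
  shows "group (maximal_subgroup S e)"
  using corner_monoid[OF assms] monoid.units_group unfolding maximal_subgroup_def by blast

lemma pow_maximal_subgroup:
  assumes "e \<in> carrier S" "e \<otimes> e = e" "x \<in> carrier (maximal_subgroup S e)"
  shows "x [^] Suc k \<in> carrier (maximal_subgroup S e)"
proof -
  interpret G: group "maximal_subgroup S e" by (rule group_maximal_subgroup) fact+
  have x: "x \<in> carrier S" using assms by (simp add: mem_maximal_subgroup_iff)
  show ?thesis
  proof (induction k)
    case (Suc k)
    then have "x [^] Suc k \<otimes>\<^bsub>maximal_subgroup S e\<^esub> x \<in> carrier (maximal_subgroup S e)"
      using assms(3) by (rule G.m_closed)
    then show ?case by (simp add: maximal_subgroup_simps)
  qed (use x assms in simp)
qed

text \<open>A commutator has the same diagonal as the identity \<open>e\<close> and finite order, so it is \<open>e\<close>.\<close>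

lemma comm_group_maximal_subgroup:
  assumes e: "e \<in> carrier S" "e \<otimes> e = e"
  shows "comm_group (maximal_subgroup S e)"
proof -
  let ?G = "maximal_subgroup S e"
  interpret G: group ?G by (rule group_maximal_subgroup) fact+
  have G_S: "g \<in> carrier S" "e \<otimes> g = g" "g \<otimes> e = g" if "g \<in> carrier ?G" for g
    using that by (auto simp: mem_maximal_subgroup_iff[OF e])
  have G_mult: "a \<otimes>\<^bsub>?G\<^esub> b = a \<otimes> b" for a b by (rule maximal_subgroup_simps)
  have inv_diag: "r g i i * r (inv\<^bsub>?G\<^esub> g) i i = r e i i" if "g \<in> carrier ?G" "i < d" for g i
  proof -
    have "g \<otimes> inv\<^bsub>?G\<^esub> g = e" using G.r_inv[OF that(1)] by (simp add: maximal_subgroup_simps)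
    then show ?thesis using r_diag_mult[of g "inv\<^bsub>?G\<^esub> g" i] that G_S by simp
  qed
  show ?thesis
  proof (rule G.group_comm_groupI)
    fix g h assume gh: "g \<in> carrier ?G" "h \<in> carrier ?G"
    define c where "c = (g \<otimes>\<^bsub>?G\<^esub> h) \<otimes>\<^bsub>?G\<^esub> inv\<^bsub>?G\<^esub> (h \<otimes>\<^bsub>?G\<^esub> g)"
    have c: "c \<in> carrier ?G" using gh by (simp add: c_def)
    have "r c i i = r e i i" if i: "i < d" for i
    proof -
      have "r c i i = r (g \<otimes> h) i i * r (inv\<^bsub>?G\<^esub> (h \<otimes>\<^bsub>?G\<^esub> g)) i i"
        unfolding c_def G_mult using gh i G_S by (intro r_diag_mult) (auto simp flip: G_mult)
      also have "r (g \<otimes> h) i i = r (h \<otimes>\<^bsub>?G\<^esub> g) i i"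
        using gh i G_S by (simp add: r_diag_mult G_mult mult.commute)
      finally show ?thesis using inv_diag[of "h \<otimes>\<^bsub>?G\<^esub> g" i] gh i by simp
    qed
    moreover obtain m where m: "m > 0" "(c [^] m) \<otimes> (c [^] m) = c [^] (m::nat)"
      using idempotent_power[OF finite_carrier, of c] c G_S by auto
    have "c [^] m \<in> carrier ?G" using pow_maximal_subgroup[OF e c, of "m - 1"] m(1) by simp
    then have "c [^] m = e"
      using m(2) G.l_cancel_one'[of "c [^] m" "c [^] m"] by (simp add: G_mult maximal_subgroup_simps)
    then have "c [^] Suc m = c" using G_S[OF c] by simp
    ultimately have "c = e"
      using periodic_eq_idempotent[OF e G_S[OF c], of m] m(1) by blast
    then show "g \<otimes>\<^bsub>?G\<^esub> h = h \<otimes>\<^bsub>?G\<^esub> g"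
      using gh G.inv_solve_right'[of "g \<otimes>\<^bsub>?G\<^esub> h" "\<one>\<^bsub>?G\<^esub>" "h \<otimes>\<^bsub>?G\<^esub> g"]
      by (simp add: c_def maximal_subgroup_simps(1)[of e])
        (metis G.inv_equality G.inv_inv G.m_closed G.inv_closed maximal_subgroup_simps(1))
  qed
qed

text \<open>Writing \<open>e = a s b\<close> shows that the diagonal of \<open>s\<close> has no zeros where that of \<open>e\<close> is nonzero. The
  idempotent power of \<open>e s e\<close> then has the diagonal of \<open>e\<close> and is therefore \<open>e\<close>, which makes \<open>e s e\<close>
  invertible.\<close>

lemma compress_in_maximal_subgroup:
  assumes e: "e \<in> carrier S" "e \<otimes> e = e" and s: "s \<in> carrier S" and J: "e \<in> principal_ideal S s"
  shows "e \<otimes> s \<otimes> e \<in> carrier (maximal_subgroup S e)"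
proof -
  obtain a b where ab: "a \<in> carrier S" "b \<in> carrier S" "e = a \<otimes> s \<otimes> b"
    using J by (auto simp: principal_ideal_def)
  define x where "x = e \<otimes> s \<otimes> e"
  have x: "x \<in> carrier S" "e \<otimes> x = x" "x \<otimes> e = x"
    using mem_corner_iff[OF e, of x] s by (auto simp: x_def corner_monoid_def)
  obtain m where m: "m > 0" "(x [^] m) \<otimes> (x [^] m) = x [^] (m::nat)"
    using idempotent_power[OF finite_carrier x(1)] by auto
  obtain k where k: "m = Suc k" using m(1) by (cases m) auto
  define f where "f = x [^] m"
  have pow_corner: "x [^] Suc l \<in> carrier S \<and> e \<otimes> x [^] Suc l = x [^] Suc l \<and> x [^] Suc l \<otimes> e = x [^] Suc l" for l
  proof (induction l)
    case (Suc l)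
    then show ?case using x e
      by (metis m_assoc m_closed nat_pow_Suc)
  qed (use x in simp)
  have f: "f \<in> carrier S" "e \<otimes> f = f" "f \<otimes> e = f" using pow_corner[of k] by (auto simp: f_def k)
  have "r f i i = r e i i" if i: "i < d" for i
  proof -
    have ee: "r e i i * r e i i = r e i i" using r_diag_mult[OF e(1) e(1) i] e by simp
    have ff: "r f i i * r f i i = r f i i" using r_diag_mult[OF f(1) f(1) i] m by (simp add: f_def)
    have eabs: "r e i i = r a i i * r s i i * r b i i"
      unfolding ab(3) using ab s i by (simp add: r_diag_mult)
    have fx: "r f i i = (r e i i * r s i i * r e i i) ^ m"
      unfolding f_def k using r_diag_pow[OF x(1) i] e s i by (simp add: x_def r_diag_mult)
    show ?thesis
    proof (cases "r e i i = 0")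
      case True
      then show ?thesis using fx m(1) by simp
    next
      case False
      then have "r f i i \<noteq> 0" using fx eabs by auto
      then show ?thesis using ee ff False by simp
    qed
  qed
  moreover have "f [^] Suc 1 = f" using f m by (simp add: f_def)
  ultimately have fe: "f = e" using periodic_eq_idempotent[OF e f, of 1] by simp
  define y where "y = e \<otimes> x [^] k \<otimes> e"
  have y: "y \<in> carrier S" "e \<otimes> y = y" "y \<otimes> e = y"
    using mem_corner_iff[OF e, of y] x by (auto simp: y_def corner_monoid_def)
  have "x \<otimes> y = (x \<otimes> e) \<otimes> x [^] k \<otimes> e" using x(1) e(1) by (simp add: y_def m_assoc)
  also have "\<dots> = f \<otimes> e" using x nat_pow_Suc2[OF x(1), of k] by (simp add: f_def k)
  finally have xy: "x \<otimes> y = e" using fe e by simp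
  have "y \<otimes> x = e \<otimes> (x [^] k \<otimes> (e \<otimes> x))" using x(1) e by (simp add: y_def m_assoc)
  also have "\<dots> = e \<otimes> f" using x by (simp add: f_def k)
  finally have yx: "y \<otimes> x = e" using fe e by simp
  show ?thesis
    unfolding x_def[symmetric] mem_maximal_subgroup_iff[OF e] using x y xy yx by blast
qed

end

section \<open>The apex of a linear character\<close>

context monoid
begin

lemma principal_ideal_self: "s \<in> carrier G \<Longrightarrow> s \<in> principal_ideal G s"
  unfolding principal_ideal_def by (force intro!: exI[of _ \<one>])

lemma principal_ideal_mono:
  assumes "s \<in> carrier G" "t \<in> principal_ideal G s"
  shows "principal_ideal G t \<subseteq> principal_ideal G s"
proof
  fix u assume "u \<in> principal_ideal G t"
  then obtain a b where ab: "a \<in> carrier G" "b \<in> carrier G" "u = a \<otimes> t \<otimes> b"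
    by (auto simp: principal_ideal_def)
  obtain a' b' where ab': "a' \<in> carrier G" "b' \<in> carrier G" "t = a' \<otimes> s \<otimes> b'"
    using assms(2) by (auto simp: principal_ideal_def)
  have "u = (a \<otimes> a') \<otimes> s \<otimes> (b' \<otimes> b)" using ab ab' assms(1) by (simp add: m_assoc)
  then show "u \<in> principal_ideal G s"
    using ab ab' unfolding principal_ideal_def by blast
qed

lemma regular_J_classD:
  assumes "J \<in> regular_J_classes G" "u \<in> J"
  shows "u \<in> carrier G" "J = J_class G u"
  using assms by (auto simp: regular_J_classes_def J_class_def)

lemma J_class_self: "u \<in> carrier G \<Longrightarrow> u \<in> J_class G u"
  by (simp add: J_class_def)

lemma J_subset_principal_iff:
  assumes "J \<in> regular_J_classes G" "u \<in> J" "s \<in> carrier G"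
  shows "J \<subseteq> principal_ideal G s \<longleftrightarrow> u \<in> principal_ideal G s"
proof
  assume u: "u \<in> principal_ideal G s"
  show "J \<subseteq> principal_ideal G s"
  proof
    fix t assume "t \<in> J"
    then have "t \<in> carrier G" "principal_ideal G t = principal_ideal G u"
      using regular_J_classD[OF assms(1,2)] by (auto simp: J_class_def)
    then show "t \<in> principal_ideal G s"
      using principal_ideal_self[of t] principal_ideal_mono[OF assms(3) u] by auto
  qed
qed (use assms in auto)

lemma J_class_le_iff:
  assumes "J \<in> regular_J_classes G" "J' \<in> regular_J_classes G" "u' \<in> J'"
  shows "J_class_le G J J' \<longleftrightarrow> J \<subseteq> principal_ideal G u'"
proof
  assume "J_class_le G J J'"
  then show "J \<subseteq> principal_ideal G u'"
    using assms(3) regular_J_classD(1)[OF assms(1)] principal_ideal_self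
    unfolding J_class_le_def by blast
next
  assume sub: "J \<subseteq> principal_ideal G u'"
  show "J_class_le G J J'"
    unfolding J_class_le_def
  proof (intro ballI)
    fix s t assume st: "s \<in> J" "t \<in> J'"
    have "principal_ideal G s \<subseteq> principal_ideal G u'"
      using principal_ideal_mono[OF regular_J_classD(1)[OF assms(2,3)]] sub st by blast
    also have "principal_ideal G u' = principal_ideal G t"
      using regular_J_classD(2)[OF assms(2,3)] st(2) by (auto simp: J_class_def)
    finally show "principal_ideal G s \<subseteq> principal_ideal G t" .
  qed
qed

lemma J_class_le_refl: "J \<in> regular_J_classes G \<Longrightarrow> J_class_le G J J"
  by (auto simp: regular_J_classes_def J_class_le_def J_class_def)

lemma J_class_le_antisym:
  assumes "J \<in> regular_J_classes G" "J' \<in> regular_J_classes G" "J_class_le G J J'" "J_class_le G J' J"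
  shows "J = J'"
proof -
  obtain u u' where u: "u \<in> J" "u' \<in> J'" using assms by (auto simp: regular_J_classes_def)
  then have "principal_ideal G u = principal_ideal G u'"
    using assms unfolding J_class_le_def by blast
  then show ?thesis
    using regular_J_classD(2)[OF assms(1) u(1)] regular_J_classD(2)[OF assms(2) u(2)]
    by (simp add: J_class_def)
qed

lemma J_class_le_trans:
  assumes "J' \<in> regular_J_classes G" "J_class_le G J J'" "J_class_le G J' J''"
  shows "J_class_le G J J''"
proof -
  obtain u where "u \<in> J'" using assms(1) by (auto simp: regular_J_classes_def)
  then show ?thesis using assms(2,3) unfolding J_class_le_def by blast
qed

lemma finite_regular_J_classes: "finite (carrier G) \<Longrightarrow> finite (regular_J_classes G)"
  by (simp add: regular_J_classes_def)

lemma Field_regular_J_order: "Field (regular_J_order G) = regular_J_classes G"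
  using J_class_le_refl by (auto simp: regular_J_order_def Field_def)

lemma partial_order_regular_J_order:
  assumes "finite (carrier G)"
  shows "finite (regular_J_order G)" "partial_order_on (Field (regular_J_order G)) (regular_J_order G)"
proof -
  have "regular_J_order G \<subseteq> regular_J_classes G \<times> regular_J_classes G"
    by (auto simp: regular_J_order_def)
  then show "finite (regular_J_order G)"
    using finite_regular_J_classes[OF assms] finite_subset by blast
  show "partial_order_on (Field (regular_J_order G)) (regular_J_order G)"
    unfolding Field_regular_J_order partial_order_on_def preorder_on_def
  proof (intro conjI)
    show "refl_on (regular_J_classes G) (regular_J_order G)"
      using J_class_le_refl by (auto simp: refl_on_def regular_J_order_def)
    show "trans (regular_J_order G)"
      using J_class_le_trans by (auto simp: trans_def regular_J_order_def)
    show "antisym (regular_J_order G)"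
      using J_class_le_antisym by (auto simp: antisym_def regular_J_order_def)
  qed (auto simp: regular_J_order_def)
qed

text \<open>The elements with \<open>\<theta> s \<noteq> 0\<close> form a submonoid. If \<open>z\<close> in it has the smallest principal ideal, then
  \<open>z\<close> and \<open>z t\<close> generate the same ideal for each \<open>t\<close> in it, so \<open>z\<close> lies below all of them; an idempotent
  power of \<open>z\<close> generates the apex.\<close>

lemma linear_character_apex:
  assumes fin: "finite (carrier G)" and \<theta>: "linear_character G \<theta>"
  obtains J where "J \<in> regular_J_classes G"
    "\<And>s. s \<in> carrier G \<Longrightarrow> \<theta> s \<noteq> 0 \<longleftrightarrow> J \<subseteq> principal_ideal G s"
proof -
  have mult: "\<theta> (s \<otimes> t) = \<theta> s * \<theta> t" if "s \<in> carrier G" "t \<in> carrier G" for s t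
    using \<theta> that by (simp add: linear_character_def)
  have fin_pi: "finite (principal_ideal G s)" if "s \<in> carrier G" for s
    by (rule finite_subset[OF _ fin]) (use that in \<open>auto simp: principal_ideal_def\<close>)
  define T where "T = {s \<in> carrier G. \<theta> s \<noteq> 0}"
  have "\<one> \<in> T" using \<theta> by (simp add: T_def linear_character_def)
  define z where "z = arg_min (\<lambda>s. card (principal_ideal G s)) (\<lambda>s. s \<in> T)"
  have z: "z \<in> T" using arg_min_natI[of "\<lambda>s. s \<in> T" \<one>] \<open>\<one> \<in> T\<close> by (simp add: z_def)
  have z_min: "card (principal_ideal G z) \<le> card (principal_ideal G s)" if "s \<in> T" for s
    using arg_min_nat_le[of "\<lambda>s. s \<in> T" s] that by (simp add: z_def)
  have zc: "z \<in> carrier G" using z by (simp add: T_def)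
  have z_eq: "principal_ideal G (z \<otimes> t) = principal_ideal G z" if t: "t \<in> T" for t
  proof (rule card_seteq)
    have tc: "t \<in> carrier G" using t by (simp add: T_def)
    have "z \<otimes> t = \<one> \<otimes> z \<otimes> t" using zc tc by simp
    then have "z \<otimes> t \<in> principal_ideal G z"
      unfolding principal_ideal_def using zc tc by blast
    then show "principal_ideal G (z \<otimes> t) \<subseteq> principal_ideal G z" by (rule principal_ideal_mono[OF zc])
    show "card (principal_ideal G z) \<le> card (principal_ideal G (z \<otimes> t))"
      using z t by (intro z_min) (auto simp: T_def mult)
  qed (rule fin_pi[OF zc])
  have z_below: "z \<in> principal_ideal G t" if t: "t \<in> T" for t
  proof -
    have tc: "t \<in> carrier G" using t by (simp add: T_def)
    have "z \<otimes> t = z \<otimes> t \<otimes> \<one>" using zc tc by simp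
    then have "z \<otimes> t \<in> principal_ideal G t"
      unfolding principal_ideal_def using zc tc by blast
    then have "principal_ideal G (z \<otimes> t) \<subseteq> principal_ideal G t" by (rule principal_ideal_mono[OF tc])
    then show ?thesis using z_eq[OF t] principal_ideal_self[OF zc] by auto
  qed
  obtain m :: nat where m: "m > 0" "(z [^] m) \<otimes> (z [^] m) = z [^] m"
    using idempotent_power[OF fin zc] .
  define u where "u = z [^] m"
  have u: "u \<in> T" using linear_character_pow[OF monoid_axioms \<theta> zc, of m] z by (simp add: T_def u_def)
  then have uc: "u \<in> carrier G" by (simp add: T_def)
  obtain k where k: "m = Suc k" using m(1) by (cases m) auto
  have "u = z [^] k \<otimes> z \<otimes> \<one>" using zc by (simp add: u_def k)
  then have "u \<in> principal_ideal G z"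
    unfolding principal_ideal_def using zc by blast
  then have u_below: "u \<in> principal_ideal G t" if "t \<in> T" for t
    using z_below[OF that] principal_ideal_mono[of t z] that by (auto simp: T_def)
  have reg: "J_class G u \<in> regular_J_classes G"
    unfolding regular_J_classes_def idempotent_elem_def
    using uc m(2) J_class_self[OF uc] by (auto simp: u_def)
  have "\<theta> s \<noteq> 0 \<longleftrightarrow> J_class G u \<subseteq> principal_ideal G s" if s: "s \<in> carrier G" for s
  proof -
    have "J_class G u \<subseteq> principal_ideal G s \<longleftrightarrow> u \<in> principal_ideal G s"
      by (rule J_subset_principal_iff[OF reg J_class_self[OF uc] s])
    moreover have "u \<in> principal_ideal G s" if "\<theta> s \<noteq> 0" using u_below s that by (simp add: T_def)
    moreover have "\<theta> s \<noteq> 0" if "u \<in> principal_ideal G s"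
    proof
      assume "\<theta> s = 0"
      from that obtain a b where "a \<in> carrier G" "b \<in> carrier G" "u = a \<otimes> s \<otimes> b"
        by (auto simp: principal_ideal_def)
      then have "\<theta> u = 0" using \<open>\<theta> s = 0\<close> s by (simp add: mult)
      then show False using u by (simp add: T_def)
    qed
    ultimately show ?thesis by blast
  qed
  then show ?thesis using that reg by blast
qed

end

section \<open>Eigenvalues and multiplicities\<close>

context triangular_monoid
begin

lemma restrict_linear_character:
  assumes e: "e \<in> carrier S" "e \<otimes> e = e" and \<theta>: "linear_character S \<theta>" "\<theta> e \<noteq> 0"
  shows "linear_character (maximal_subgroup S e) \<theta>"
proof -
  have "\<theta> e * \<theta> e = \<theta> e" using \<theta>(1) e unfolding linear_character_def by metis
  then have "\<theta> e = 1" using \<theta>(2) by simp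
  then show ?thesis using \<theta>(1)
    by (simp add: linear_character_def maximal_subgroup_simps mem_maximal_subgroup_iff[OF e])
qed

lemma finite_maximal_subgroup:
  assumes "e \<in> carrier S" "e \<otimes> e = e"
  shows "finite (carrier (maximal_subgroup S e))"
  by (rule finite_subset[OF _ finite_carrier]) (auto simp: mem_maximal_subgroup_iff[OF assms])

lemma apex_eigenvalue:
  assumes e: "e J \<in> J" "idempotent_elem S (e J)" and J: "J \<in> regular_J_classes S"
    and \<theta>: "linear_character S \<theta>"
    and apex: "\<And>s. s \<in> carrier S \<Longrightarrow> \<theta> s \<noteq> 0 \<longleftrightarrow> J \<subseteq> principal_ideal S s"
  shows "walk_eigenvalue S p e J (restrict \<theta> (carrier (maximal_subgroup S (e J))))
     = (\<Sum>s\<in>carrier S. complex_of_real (p s) * \<theta> s)"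
proof -
  have ec: "e J \<in> carrier S" "e J \<otimes> e J = e J" using e by (auto simp: idempotent_elem_def)
  have "\<theta> (e J) \<noteq> 0" using apex[OF ec(1)] J_subset_principal_iff[OF J e(1) ec(1)]
      principal_ideal_self[OF ec(1)] by simp
  moreover have "\<theta> (e J) * \<theta> (e J) = \<theta> (e J)"
    using \<theta> ec unfolding linear_character_def by metis
  ultimately have e1: "\<theta> (e J) = 1" by simp
  have "walk_eigenvalue S p e J (restrict \<theta> (carrier (maximal_subgroup S (e J))))
      = (\<Sum>s\<in>{s \<in> carrier S. J \<subseteq> principal_ideal S s}. complex_of_real (p s) * \<theta> s)"
    unfolding walk_eigenvalue_def
  proof (rule sum.cong[OF refl])
    fix s assume "s \<in> {s \<in> carrier S. J \<subseteq> principal_ideal S s}"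
    then have s: "s \<in> carrier S" "e J \<in> principal_ideal S s" using e(1) by auto
    have "\<theta> (e J \<otimes> s \<otimes> e J) = \<theta> s" using \<theta> s(1) ec e1 by (simp add: linear_character_def)
    then show "complex_of_real (p s) * restrict \<theta> (carrier (maximal_subgroup S (e J))) (e J \<otimes> s \<otimes> e J)
        = complex_of_real (p s) * \<theta> s"
      using compress_in_maximal_subgroup[OF ec s] by simp
  qed
  also have "\<dots> = (\<Sum>s\<in>carrier S. complex_of_real (p s) * \<theta> s)"
    by (rule sum.mono_neutral_left) (use finite_carrier apex in auto)
  finally show ?thesis .
qed

text \<open>By multiplicativity \<open>\<theta> (e' g e')\<close> is \<open>\<theta> g\<close> or 0 according to whether the class of \<open>e'\<close> lies above the
  apex, so the sum runs over an interval and Moebius inversion applies.\<close>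

lemma apex_moebius_sum:
  assumes e: "\<And>J. J \<in> regular_J_classes S \<Longrightarrow> e J \<in> J \<and> idempotent_elem S (e J)"
    and J: "J \<in> regular_J_classes S" "J0 \<in> regular_J_classes S"
    and \<theta>: "linear_character S \<theta>"
    and apex: "\<And>s. s \<in> carrier S \<Longrightarrow> \<theta> s \<noteq> 0 \<longleftrightarrow> J0 \<subseteq> principal_ideal S s"
    and g: "g \<in> carrier S"
  shows "(\<Sum>J'\<in>{J' \<in> regular_J_classes S. J_class_le S J' J}.
      \<theta> (e J' \<otimes> g \<otimes> e J') * of_int (moebius (regular_J_order S) J' J)) = (if J0 = J then \<theta> g else 0)"
proof -
  let ?r = "regular_J_order S"
  have ec: "e J' \<in> carrier S" "e J' \<otimes> e J' = e J'" "e J' \<in> J'" if "J' \<in> regular_J_classes S" for J'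
    using e[OF that] by (auto simp: idempotent_elem_def)
  have val: "\<theta> (e J' \<otimes> g \<otimes> e J') = (if J_class_le S J0 J' then \<theta> g else 0)"
    if J': "J' \<in> regular_J_classes S" for J'
  proof -
    have "\<theta> (e J') * \<theta> (e J') = \<theta> (e J')"
      using \<theta> ec[OF J'] unfolding linear_character_def by metis
    then have "\<theta> (e J') = (if \<theta> (e J') \<noteq> 0 then 1 else 0)" by auto
    also have "\<dots> = (if J_class_le S J0 J' then 1 else 0)"
      using apex[OF ec(1)[OF J']] J_class_le_iff[OF J(2) J' ec(3)[OF J']] by simp
    finally have "\<theta> (e J') = (if J_class_le S J0 J' then 1 else 0)" .
    then show ?thesis using \<theta> g ec(1)[OF J'] by (simp add: linear_character_def)
  qed
  have fin: "finite {J' \<in> regular_J_classes S. J_class_le S J' J}"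
    using finite_regular_J_classes[OF finite_carrier] by simp
  have "(\<Sum>J'\<in>{J' \<in> regular_J_classes S. J_class_le S J' J}.
      \<theta> (e J' \<otimes> g \<otimes> e J') * of_int (moebius ?r J' J))
    = (\<Sum>J'\<in>{J' \<in> regular_J_classes S. J_class_le S J' J}.
         if J_class_le S J0 J' then \<theta> g * of_int (moebius ?r J' J) else 0)"
    by (rule sum.cong) (auto simp: val)
  also have "\<dots> = (\<Sum>J'\<in>{J'. (J0, J') \<in> ?r \<and> (J', J) \<in> ?r}. \<theta> g * of_int (moebius ?r J' J))"
    unfolding sum.inter_filter[OF fin, symmetric]
    by (rule sum.cong) (use J in \<open>auto simp: regular_J_order_def\<close>)
  also have "\<dots> = \<theta> g * of_int (\<Sum>J'\<in>{J'. (J0, J') \<in> ?r \<and> (J', J) \<in> ?r}. moebius ?r J' J)"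
    by (simp add: sum_distrib_left)
  also have "\<dots> = (if J0 = J then \<theta> g else 0)"
  proof (cases "J_class_le S J0 J")
    case True
    then have "(J0, J) \<in> ?r" using J by (simp add: regular_J_order_def)
    then show ?thesis
      by (simp add: moebius_sum_left[OF partial_order_regular_J_order[OF finite_carrier]]
          del: of_int_sum)
  next
    case False
    have "\<not> ((J0, J') \<in> ?r \<and> (J', J) \<in> ?r)" for J'
      using False J_class_le_trans[of J' J0 J] by (auto simp: regular_J_order_def)
    then have empty: "{J'. (J0, J') \<in> ?r \<and> (J', J) \<in> ?r} = {}" by blast
    have "J0 \<noteq> J" using False J_class_le_refl J by auto
    then show ?thesis unfolding empty by simp
  qed
  finally show ?thesis .
qed

end

lemma order_prod_linear:
  fixes c :: "'i \<Rightarrow> complex"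
  assumes "finite I"
  shows "Polynomial.order z (\<Prod>i\<in>I. [:- c i, 1:]) = card {i \<in> I. c i = z}"
  using assms
proof (induction I rule: finite_induct)
  case (insert a I)
  have eq: "(\<Prod>i\<in>insert a I. [:- c i, 1:]) = [:- c a, 1:] * (\<Prod>i\<in>I. [:- c i, 1:])"
    by (rule prod.insert[OF insert.hyps])
  have "(\<Prod>i\<in>insert a I. [:- c i, 1:]) \<noteq> 0"
    using insert.hyps(1) by (subst prod_zero_iff) auto
  then have "Polynomial.order z (\<Prod>i\<in>insert a I. [:- c i, 1:]) =
      Polynomial.order z [:- c a, 1:] + card {i \<in> I. c i = z}"
    unfolding eq insert.IH[symmetric] by (rule Polynomial.order_mult)
  moreover have "Polynomial.order z [:- c a, 1:] = (if c a = z then 1 else 0)"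
    using Polynomial.order_0I[of "[:- c a, 1:]" z] Polynomial.order_power_n_n[of z 1] by auto
  moreover have "{i \<in> insert a I. c i = z} =
      (if c a = z then insert a {i \<in> I. c i = z} else {i \<in> I. c i = z})" by auto
  ultimately show ?case using insert.hyps by simp
qed (simp add: Polynomial.order_0I)

theorem mainTheorem8:
  fixes S :: "('a, 'b) monoid_scheme"
    and p :: "'a \<Rightarrow> real"
    and L :: "'a set"
    and ix :: "nat \<Rightarrow> 'a"
    and e :: "'a set \<Rightarrow> 'a"
  assumes "monoid S"
    and "finite (carrier S)"
    and "triangularizable S"
    and "\<And>s. s \<in> carrier S \<Longrightarrow> p s \<ge> 0"
    and "(\<Sum>s\<in>carrier S. p s) = 1"
    and "minimal_left_ideal S L"
    and "bij_betw ix {..<card L} L"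
    and "\<And>J. J \<in> regular_J_classes S \<Longrightarrow> e J \<in> J \<and> idempotent_elem S (e J)"
  shows "(\<forall>J\<in>regular_J_classes S. \<forall>\<chi>\<in>irr_characters (maximal_subgroup S (e J)).
            walk_multiplicity S L e J \<chi> \<in> \<nat>) \<and>
         (\<forall>z. of_nat (Polynomial.order z (char_poly (walk_matrix S p (card L) ix))) =
            (\<Sum>J\<in>regular_J_classes S.
               \<Sum>\<chi>\<in>{\<chi> \<in> irr_characters (maximal_subgroup S (e J)).
                         walk_eigenvalue S p e J \<chi> = z}.
                 walk_multiplicity S L e J \<chi>))"
proof -
  obtain d r where "triangular_monoid S d r"
    using triangularizable_imp_triangular_monoid[OF assms(1,2,3)] .
  then interpret triangular_monoid S d r .
  define n where "n = card L"
  interpret triangular_walk S d r L n ix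
    by unfold_locales (use assms in \<open>auto simp: minimal_left_ideal_def n_def\<close>)
  obtain \<theta> where \<theta>: "\<And>i. i < n \<Longrightarrow> linear_character S (\<theta> i)"
    and fixed: "\<And>s. s \<in> carrier S \<Longrightarrow> of_nat (card (Fix_on S L s)) = (\<Sum>i<n. \<theta> i s)"
    and cp: "\<And>p. char_poly (walk_matrix S p n ix) =
       (\<Prod>i<n. [:- (\<Sum>s\<in>carrier S. complex_of_real (p s) * \<theta> i s), 1:])"
    using walk_decomposition by blast
  have "\<forall>i\<in>{..<n}. \<exists>J. J \<in> regular_J_classes S \<and>
      (\<forall>s\<in>carrier S. \<theta> i s \<noteq> 0 \<longleftrightarrow> J \<subseteq> principal_ideal S s)"
    using linear_character_apex[OF finite_carrier \<theta>] by (metis lessThan_iff)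
  then obtain A where A: "\<And>i. i < n \<Longrightarrow> A i \<in> regular_J_classes S"
    and apex: "\<And>i s. i < n \<Longrightarrow> s \<in> carrier S \<Longrightarrow> \<theta> i s \<noteq> 0 \<longleftrightarrow> A i \<subseteq> principal_ideal S s"
    by (metis lessThan_iff)
  let ?G = "\<lambda>J. maximal_subgroup S (e J)"
  have e: "e J \<in> carrier S" "e J \<otimes>\<^bsub>S\<^esub> e J = e J" "e J \<in> J" if "J \<in> regular_J_classes S" for J
    using assms(8)[OF that] by (auto simp: idempotent_elem_def)
  have G_comm: "comm_group (?G J)" and G_fin: "finite (carrier (?G J))"
    if "J \<in> regular_J_classes S" for J
    using comm_group_maximal_subgroup finite_maximal_subgroup e[OF that] by blast+
  have G_group: "group (?G J)" if "J \<in> regular_J_classes S" for J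
    using group_maximal_subgroup e[OF that] by blast
  have G_pos: "card (carrier (?G J)) > 0" if "J \<in> regular_J_classes S" for J
    using monoid.one_closed[OF group.is_monoid[OF G_group[OF that]]] G_fin[OF that] by (auto simp: card_gt_0_iff)
  define X where "X i = restrict (\<theta> i) (carrier (?G (A i)))" for i
  have \<theta>_G: "linear_character (?G (A i)) (\<theta> i)" if i: "i < n" for i
  proof (rule restrict_linear_character)
    show "\<theta> i (e (A i)) \<noteq> 0"
      using apex[OF i] e[OF A[OF i]] J_subset_principal_iff[OF A[OF i] e(3)[OF A[OF i]]]
        principal_ideal_self by simp
  qed (use \<theta> i e A in auto)
  have X_irr: "X i \<in> irr_characters (?G (A i))" if i: "i < n" for i
    unfolding irr_characters_comm_group[OF G_comm[OF A[OF i]]] X_def using \<theta>_G[OF i] by blast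

  have mult: "walk_multiplicity S L e J \<chi> = of_nat (card {i. i < n \<and> A i = J \<and> X i = \<chi>})"
    if J: "J \<in> regular_J_classes S" and \<chi>: "\<chi> \<in> irr_characters (?G J)" for J \<chi>
  proof -
    obtain \<eta> where \<eta>: "linear_character (?G J) \<eta>" "\<chi> = restrict \<eta> (carrier (?G J))"
      using \<chi> by (auto simp: irr_characters_comm_group[OF G_comm[OF J]])
    let ?K = "{J' \<in> regular_J_classes S. J_class_le S J' J}"
    let ?mu = "\<lambda>J'. of_int (moebius (regular_J_order S) J' J) :: complex"
    have GS: "g \<in> carrier S" if "g \<in> carrier (?G J)" for g
      using that by (simp add: mem_maximal_subgroup_iff[OF e(1,2)[OF J]])
    have inner: "(\<Sum>J'\<in>?K. of_nat (card (Fix_on S L (e J' \<otimes>\<^bsub>S\<^esub> g \<otimes>\<^bsub>S\<^esub> e J'))) * ?mu J')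
        = (\<Sum>i<n. if A i = J then \<theta> i g else 0)" if g: "g \<in> carrier (?G J)" for g
    proof -
      have "(\<Sum>J'\<in>?K. of_nat (card (Fix_on S L (e J' \<otimes>\<^bsub>S\<^esub> g \<otimes>\<^bsub>S\<^esub> e J'))) * ?mu J')
          = (\<Sum>J'\<in>?K. \<Sum>i<n. \<theta> i (e J' \<otimes>\<^bsub>S\<^esub> g \<otimes>\<^bsub>S\<^esub> e J') * ?mu J')"
        using e GS[OF g] by (intro sum.cong refl) (simp add: fixed sum_distrib_right)
      also have "\<dots> = (\<Sum>i<n. \<Sum>J'\<in>?K. \<theta> i (e J' \<otimes>\<^bsub>S\<^esub> g \<otimes>\<^bsub>S\<^esub> e J') * ?mu J')"
        by (rule sum.swap)
      also have "\<dots> = (\<Sum>i<n. if A i = J then \<theta> i g else 0)"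
        by (intro sum.cong refl apex_moebius_sum assms(8) J A \<theta> apex GS[OF g]) auto
      finally show ?thesis .
    qed
    have ortho: "(\<Sum>g\<in>carrier (?G J). \<eta> (inv\<^bsub>?G J\<^esub> g) * (if A i = J then \<theta> i g else 0))
        = (if A i = J \<and> X i = \<chi> then of_nat (card (carrier (?G J))) else 0)" if i: "i < n" for i
    proof (cases "A i = J")
      case True
      have "X i = \<chi> \<longleftrightarrow> (\<forall>g\<in>carrier (?G J). \<eta> g = \<theta> i g)"
        using True by (auto simp: X_def \<eta>(2) restrict_def fun_eq_iff)
      then show ?thesis
        using linear_character_orthogonality[OF G_group[OF J] G_fin[OF J] \<eta>(1), of "\<theta> i"]
          \<theta>_G[OF i] True by simp
    qed simp
    have "walk_multiplicity S L e J \<chi> = 1 / of_nat (card (carrier (?G J))) *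
        (\<Sum>g\<in>carrier (?G J). \<eta> (inv\<^bsub>?G J\<^esub> g) * (\<Sum>i<n. if A i = J then \<theta> i g else 0))"
      unfolding walk_multiplicity_def Let_def
      using group.inv_closed[OF G_group[OF J]]
      by (intro arg_cong2[of _ _ _ _ "(*)"] sum.cong refl) (auto simp: inner \<eta>(2))
    also have "(\<Sum>g\<in>carrier (?G J). \<eta> (inv\<^bsub>?G J\<^esub> g) * (\<Sum>i<n. if A i = J then \<theta> i g else 0))
        = (\<Sum>i<n. \<Sum>g\<in>carrier (?G J). \<eta> (inv\<^bsub>?G J\<^esub> g) * (if A i = J then \<theta> i g else 0))"
      unfolding sum_distrib_left by (rule sum.swap)
    also have "\<dots> = (\<Sum>i<n. if A i = J \<and> X i = \<chi> then of_nat (card (carrier (?G J))) else 0)"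
      using ortho by (intro sum.cong) auto
    also have "\<dots> = of_nat (card {i \<in> {..<n}. A i = J \<and> X i = \<chi>}) * of_nat (card (carrier (?G J)))"
      by (subst sum.inter_filter[symmetric]) auto
    finally show ?thesis using G_pos[OF J] by simp
  qed

  have eig: "walk_eigenvalue S p e (A i) (X i) = (\<Sum>s\<in>carrier S. complex_of_real (p s) * \<theta> i s)"
    if i: "i < n" for i
    unfolding X_def using assms(8)[OF A[OF i]] A[OF i] \<theta>[OF i] apex[OF i]
    by (intro apex_eigenvalue) auto

  have "of_nat (Polynomial.order z (char_poly (walk_matrix S p n ix))) =
            (\<Sum>J\<in>regular_J_classes S.
               \<Sum>\<chi>\<in>{\<chi> \<in> irr_characters (?G J). walk_eigenvalue S p e J \<chi> = z}.
                 walk_multiplicity S L e J \<chi>)" for z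
  proof -
    let ?Y = "\<lambda>J. {\<chi> \<in> irr_characters (?G J). walk_eigenvalue S p e J \<chi> = z}"
    let ?I = "{i \<in> {..<n}. (\<Sum>s\<in>carrier S. complex_of_real (p s) * \<theta> i s) = z}"
    have fin_Y: "finite (?Y J)" if "J \<in> regular_J_classes S" for J
      using finite_irr_characters[OF G_comm[OF that] G_fin[OF that]] by simp
    have fin_J: "finite (regular_J_classes S)" by (rule finite_regular_J_classes[OF finite_carrier])
    \<comment> \<open>sort the indices by apex and restricted character, which determine the eigenvalue\<close>
    have "?I = (\<Union>(J, \<chi>)\<in>(SIGMA J:regular_J_classes S. ?Y J). {i. i < n \<and> A i = J \<and> X i = \<chi>})"
      using A X_irr eig by auto
    also have "card \<dots> = (\<Sum>(J, \<chi>)\<in>(SIGMA J:regular_J_classes S. ?Y J).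
        card {i. i < n \<and> A i = J \<and> X i = \<chi>})"
      by (subst card_UN_disjoint) (use fin_Y fin_J in \<open>auto simp: split_def\<close>)
    also have "\<dots> = (\<Sum>J\<in>regular_J_classes S. \<Sum>\<chi>\<in>?Y J. card {i. i < n \<and> A i = J \<and> X i = \<chi>})"
      using fin_Y fin_J by (subst sum.Sigma) auto
    finally have "of_nat (card ?I) = (\<Sum>J\<in>regular_J_classes S. \<Sum>\<chi>\<in>?Y J. walk_multiplicity S L e J \<chi>)"
      by (simp add: mult)
    then show ?thesis by (simp add: cp order_prod_linear)
  qed
  then show ?thesis using mult by (auto simp: n_def)
qed

end
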